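(* Let $n\ge 2$ and $m\ge 1$ be integers. (1) For every pair of non-negative integers $(p,q)$ with $p+q=m$, the space $H(C(S^1)_{(n)},m)_{p,q}$ of invertible hermitian matrix-valued functions in $M_m(C(S^1)_{(n)})$ with signature $(p,q)$ is path-connected. (2) The space $H(C(S^1)_{(n)},m)$ has $m+1$ path-connected components, which are labeled by matrix signatures. Consequently, the signature induces a bijection $\mathcal V_0(C(S^1)_{(n)},m)\cong\{-m,-m+2,\ldots,m\}$.
   Context: $C(S^1)_{(n)}$ is the Fej\'er--Riesz operator system: the space of functions $a\in C(S^1)$ of the form $a(z)=\sum_{k=-n+1}^{n-1}a_kz^k$, $z\in S^1$, with $a_k\in\mathbb C$. $M_m(C(S^1)_{(n)})$ is identified with the space of functions $a(z)=\sum_{k=-n+1}^{n-1}a_kz^k$ on $S^1$ with $a_k\in M_m(\mathbb C)$. Define $$H(C(S^1)_{(n)},m)=\{a\in M_m(C(S^1)_{(n)})\mid a=a^*,\ \det a(z)\ne0\text{ for all }z\in S^1\},$$ where $a=a^*$ means that $a(z)$ is a hermitian matrix for all $z\in S^1$; the topology is that of the finite-dimensional vector space $M_m(C(S^1)_{(n)})$. For such $a$ the signature $(p,q)$ of $a(z)$ ($p$ positive and $q$ negative eigenvalues, $p+q=m$) is independent of $z\in S^1$ and is called the signature of $a$; $H(C(S^1)_{(n)},m)_{p,q}$ is the subset of elements with signature $(p,q)$. $\mathcal V_0(C(S^1)_{(n)},m):=\pi_0(H(C(S^1)_{(n)},m))$ is the set of path components; the integer label of signature $(p,q)$ is $p-q$.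 *)

theory Defs
  imports "HOL-Analysis.Analysis" "HOL-Computational_Algebra.Polynomial"
begin

section \<open>Signatures of hermitian matrices\<close>

definition conj_transpose :: "complex^'m^'m \<Rightarrow> complex^'m^'m" where
  "conj_transpose A = (\<chi> i j. cnj (A $ j $ i))"

definition hermitian_mat :: "complex^'m^'m \<Rightarrow> bool" where
  "hermitian_mat A \<longleftrightarrow> conj_transpose A = A"

text \<open>The determinant is taken over the polynomial ring, as in \<open>det (x I - A)\<close>.\<close>

definition charpoly :: "complex^'m^'m \<Rightarrow> complex poly" where
  "charpoly A = det (\<chi> i j. (if i = j then [:0, 1:] else 0) - [:A $ i $ j:])"

text \<open>Eigenvalues are counted with multiplicity, as roots of the characteristic polynomial.\<close>

definition num_pos_eigenvalues :: "complex^'m^'m \<Rightarrow> nat" where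
  "num_pos_eigenvalues A =
     (\<Sum>x | 0 < x \<and> poly (charpoly A) (complex_of_real x) = 0.
        order (complex_of_real x) (charpoly A))"

definition num_neg_eigenvalues :: "complex^'m^'m \<Rightarrow> nat" where
  "num_neg_eigenvalues A =
     (\<Sum>x | x < 0 \<and> poly (charpoly A) (complex_of_real x) = 0.
        order (complex_of_real x) (charpoly A))"

definition signature :: "complex^'m^'m \<Rightarrow> nat \<times> nat" where
  "signature A = (num_pos_eigenvalues A, num_neg_eigenvalues A)"

definition signature_label :: "nat \<times> nat \<Rightarrow> int" where
  "signature_label s = int (fst s) - int (snd s)"

lemma poly_charpoly: "poly (charpoly A) x = det (mat x - A)"
proof -
  have "poly ((\<chi> i j. (if i = j then [:0, 1:] else 0) - [:A $ i $ j:]) $ i $ j) x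
          = (mat x - A) $ i $ j" for i j
    by (simp add: mat_def)
  then show ?thesis
    by (simp add: charpoly_def det_def poly_sum poly_prod del: vec_lambda_beta
        vector_minus_component flip: of_int_poly)
qed


section \<open>Matrices over the Fejer--Riesz operator system\<close>

text \<open>
  The size \<open>m\<close> of the matrices is \<open>CARD('m)\<close>. Functions on the circle are represented as
  extensional functions, undefined off the circle, so that equality is equality on the circle.
\<close>

definition fejer_riesz_mat :: "nat \<Rightarrow> (complex \<Rightarrow> complex^'m^'m) set" where
  "fejer_riesz_mat n =
     {a. \<exists>c :: int \<Rightarrow> complex^'m^'m. a = restrict
        (\<lambda>z. \<chi> i j. \<Sum>k = - int n + 1..int n - 1. z powi k * c k $ i $ j) (sphere 0 1)}"

text \<open>
  The finite-dimensional vector space \<^term>\<open>fejer_riesz_mat n\<close> is topologised by the supremum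
  norm, as a subspace of the continuous matrix-valued functions on the circle. Every norm on it
  gives the same topology.
\<close>

definition fejer_riesz_topology :: "nat \<Rightarrow> (complex \<Rightarrow> complex^'m^'m) topology" where
  "fejer_riesz_topology n =
     subtopology (mtopology_of (cfunspace (top_of_set (sphere 0 1)) euclidean_metric))
       (fejer_riesz_mat n)"

definition herm_inv :: "nat \<Rightarrow> (complex \<Rightarrow> complex^'m^'m) set" where
  "herm_inv n = {a \<in> fejer_riesz_mat n.
     (\<forall>z \<in> sphere 0 1. hermitian_mat (a z)) \<and> (\<forall>z \<in> sphere 0 1. det (a z) \<noteq> 0)}"

definition herm_inv_topology :: "nat \<Rightarrow> (complex \<Rightarrow> complex^'m^'m) topology" where
  "herm_inv_topology n = subtopology (fejer_riesz_topology n) (herm_inv n)"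

definition herm_inv_sig :: "nat \<Rightarrow> nat \<Rightarrow> nat \<Rightarrow> (complex \<Rightarrow> complex^'m^'m) set" where
  "herm_inv_sig n p q = {a \<in> herm_inv n. \<forall>z \<in> sphere 0 1. signature (a z) = (p, q)}"

definition V0 :: "nat \<Rightarrow> (complex \<Rightarrow> complex^'m^'m) set set" where
  "V0 n = path_components_of (herm_inv_topology n)"

lemma fejer_riesz_mat_subset_cfunspace:
  "fejer_riesz_mat n \<subseteq> mspace (cfunspace (top_of_set (sphere 0 1)) euclidean_metric)"
proof
  fix a :: "complex \<Rightarrow> complex^'m^'m"
  assume "a \<in> fejer_riesz_mat n"
  then obtain c :: "int \<Rightarrow> complex^'m^'m" where a: "a = restrict
        (\<lambda>z. \<chi> i j. \<Sum>k = - int n + 1..int n - 1. z powi k * c k $ i $ j) (sphere 0 1)"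
    by (auto simp: fejer_riesz_mat_def)
  have "continuous_on (sphere 0 1)
      (\<lambda>z. (\<chi> i j. \<Sum>k = - int n + 1..int n - 1. z powi k * c k $ i $ j) :: complex^'m^'m)"
    by (intro continuous_intros) auto
  then have "continuous_on (sphere 0 1) a"
    by (rule continuous_on_eq) (simp add: a)
  moreover have "compactin (top_of_set (sphere 0 1)) (topspace (top_of_set (sphere (0::complex) 1)))"
    by (simp add: compactin_subtopology)
  ultimately show "a \<in> mspace (cfunspace (top_of_set (sphere 0 1)) euclidean_metric)"
    by (subst compactin_mspace_cfunspace) (auto simp: a)
qed

lemma topspace_fejer_riesz_topology: "topspace (fejer_riesz_topology n) = fejer_riesz_mat n"
  unfolding fejer_riesz_topology_def topspace_subtopology topspace_mtopology_of
  using fejer_riesz_mat_subset_cfunspace by blast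

lemma topspace_herm_inv_topology: "topspace (herm_inv_topology n) = herm_inv n"
  by (auto simp: herm_inv_topology_def topspace_fejer_riesz_topology herm_inv_def)

end

theory Submission
  imports Defs "HOL-Complex_Analysis.Cauchy_Integral_Formula"
    "HOL-Computational_Algebra.Fundamental_Theorem_Algebra"
begin

text \<open>
  Write \<open>d = n - 1\<close>, so that the functions at hand are the hermitian matrix-valued Laurent
  polynomials of degree at most \<open>d\<close> on the circle. The signature is locally constant on invertible
  hermitian matrices (lemma \<open>signature_locally_constant\<close>), so it is constant along the circle and along
  paths. It remains to join every such \<open>a\<close>, inside the set of invertible ones, to a constant diagonal
  matrix with entries \<open>1\<close> and \<open>-1\<close>, chosen by the signature alone. The difficulty is that the degree
  must not grow along the path.

  The idea is to use factorizations \<open>a = Q\<^sup>* H Q\<close> on the circle, where \<open>H\<close> is a constant hermitian matrix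
  and \<open>Q\<close> is a matrix polynomial in \<open>z\<close> of degree at most \<open>d\<close> that is invertible on the closed unit disc.
  Given one, \<open>Q(t z)\<^sup>* H Q(t z)\<close> for \<open>t\<close> from \<open>1\<close> to \<open>0\<close> is a path of invertible elements of the same
  degree that ends in a constant. A constant matrix is then moved to the diagonal one by congruence along
  a path in the connected group of invertible complex matrices (Sylvester's law of inertia).

  Not every \<open>a\<close> has such a factorization: in the language of Wiener-Hopf factorization, all partial
  indices have to vanish, equivalently the Toeplitz operator with symbol \<open>a\<close> has to be invertible.
  However, this Toeplitz operator is self-adjoint and Fredholm, so \<open>0\<close> is at most an isolated point of its
  spectrum, and the symbol \<open>a + \<epsilon> I\<close> is good for arbitrarily small \<open>\<epsilon> > 0\<close>. The straight segment from \<open>a\<close> to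
  \<open>a + \<epsilon> I\<close> is the first piece of the path.

  Everything is carried out without operator theory. Invertibility of the Toeplitz operator is replaced by
  a nondegeneracy condition on the span of the modes \<open>z\<^sup>-\<^sup>1, \<dots>, z\<^sup>-\<^sup>d\<close> (definition
  \<open>toeplitz_nondegenerate\<close>), which concerns only \<open>m d\<close> linear equations. Values \<open>\<epsilon>\<close> that violate it come
  with solutions that are orthogonal in \<open>L\<^sup>2\<close> of the circle, and a dimension count allows at most \<open>m d\<close> of
  them below the gap of the spectrum of \<open>a\<close> around \<open>0\<close> (lemma \<open>nondegenerate_perturbation\<close>). If the condition
  holds, the columns of \<open>Q\<^sup>*\<close> are found by solving these linear equations
  (\<open>toeplitz_column_solution\<close>), partial fractions show that \<open>a\<^sup>-\<^sup>1 Q\<^sup>*\<close> extends holomorphically into the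
  disc (\<open>toeplitz_column_holomorphic\<close>), and the symmetry principle yields the factorization
  (\<open>hermitian_symbol_factorization\<close>).
\<close>

section \<open>Underdetermined linear systems\<close>

text \<open>
  Gaussian elimination of one equation and one unknown; every dimension count below reduces to this.
  Index sets are used rather than types because one of the applications has \<open>m d\<close> equations, where \<open>d\<close> is a
  variable.
\<close>

lemma underdetermined_system:
  fixes A :: "'i \<Rightarrow> 'j \<Rightarrow> 'k::field"
  assumes "finite I" "finite J" "card I < card J"
  shows "\<exists>x. (\<exists>j\<in>J. x j \<noteq> 0) \<and> (\<forall>i\<in>I. (\<Sum>j\<in>J. A i j * x j) = 0)"
  using assms
proof (induction I arbitrary: A J rule: finite_induct)
  case empty
  then have "J \<noteq> {}" by auto
  then show ?case by (intro exI[of _ "\<lambda>_. 1"]) auto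
next
  case (insert i0 I)
  show ?case
  proof (cases "\<forall>j\<in>J. A i0 j = 0")
    case True
    have "card I < card J" using insert by simp
    then obtain x where x: "\<exists>j\<in>J. x j \<noteq> 0" "\<forall>i\<in>I. (\<Sum>j\<in>J. A i j * x j) = 0"
      using insert.IH[of J A] insert.prems by blast
    then show ?thesis using True by (intro exI[of _ x]) auto
  next
    case False
    then obtain j0 where j0: "j0 \<in> J" "A i0 j0 \<noteq> 0" by blast
    have "card I < card (J - {j0})" using insert j0 by simp
    from insert.IH[OF _ this, of "\<lambda>i j. A i j - A i j0 * A i0 j / A i0 j0"] insert.prems
    obtain x where x: "\<exists>j\<in>J - {j0}. x j \<noteq> 0"
      "\<forall>i\<in>I. (\<Sum>j\<in>J - {j0}. (A i j - A i j0 * A i0 j / A i0 j0) * x j) = 0"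
      by auto
    define y where "y j = (if j = j0 then - (\<Sum>j\<in>J - {j0}. A i0 j * x j) / A i0 j0 else x j)" for j
    have split: "(\<Sum>j\<in>J. A i j * y j) = (\<Sum>j\<in>J - {j0}. (A i j - A i j0 * A i0 j / A i0 j0) * x j)" for i
    proof -
      have "(\<Sum>j\<in>J. A i j * y j) = A i j0 * y j0 + (\<Sum>j\<in>J - {j0}. A i j * y j)"
        using j0 insert.prems by (simp add: sum.remove)
      also have "(\<Sum>j\<in>J - {j0}. A i j * y j) = (\<Sum>j\<in>J - {j0}. A i j * x j)"
        by (intro sum.cong) (auto simp: y_def)
      finally show ?thesis
        by (simp add: y_def sum_subtractf algebra_simps sum_distrib_left sum_divide_distrib)
    qed
    have "(\<Sum>j\<in>J. A i0 j * y j) = 0" unfolding split using j0 by simp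
    moreover have "\<exists>j\<in>J. y j \<noteq> 0" using x(1) by (auto simp: y_def)
    ultimately show ?thesis using x(2) split by (intro exI[of _ y]) auto
  qed
qed


section \<open>Hermitian matrices and their eigenbases\<close>

definition cinner :: "complex^'m \<Rightarrow> complex^'m \<Rightarrow> complex" where
  "cinner x y = (\<Sum>i\<in>UNIV. cnj (x $ i) * y $ i)"

lemma cinner_simps [simp]:
  "cinner (x + y) z = cinner x z + cinner y z" "cinner z (x + y) = cinner z x + cinner z y"
  "cinner (x - y) z = cinner x z - cinner y z" "cinner z (x - y) = cinner z x - cinner z y"
  "cinner (c *s x) y = cnj c * cinner x y" "cinner x (c *s y) = c * cinner x y"
  "cinner (- x) y = - cinner x y" "cinner x (- y) = - cinner x y"
  "cinner 0 y = 0" "cinner x 0 = 0"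
  by (simp_all add: cinner_def algebra_simps sum.distrib sum_distrib_left sum_subtractf sum_negf)

lemma cinner_sum_left: "cinner (\<Sum>i\<in>I. f i) y = (\<Sum>i\<in>I. cinner (f i) y)"
  by (induction I rule: infinite_finite_induct) auto

lemma cinner_sum_right: "cinner y (\<Sum>i\<in>I. f i) = (\<Sum>i\<in>I. cinner y (f i))"
  by (induction I rule: infinite_finite_induct) auto

lemma cnj_cinner [simp]: "cnj (cinner x y) = cinner y x"
  by (simp add: cinner_def mult.commute)

lemma Re_cinner_commute: "Re (cinner x y) = Re (cinner y x)"
  by (metis cnj.simps(1) cnj_cinner)

lemma cinner_self: "cinner x x = complex_of_real ((norm x)\<^sup>2)"
proof -
  have "(norm x)\<^sup>2 = (\<Sum>i\<in>UNIV. (norm (x $ i))\<^sup>2)"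
    by (simp add: norm_vec_def L2_set_def sum_nonneg)
  then show ?thesis
    by (simp add: cinner_def complex_norm_square mult.commute del: of_real_power)
qed

lemma cinner_eq_0_iff [simp]: "cinner x x = 0 \<longleftrightarrow> x = 0"
  by (simp add: cinner_self)

lemma cinner_axis: "cinner (axis i 1) x = x $ i"
proof -
  have "cinner (axis i 1) x = (\<Sum>j\<in>UNIV. if j = i then x $ j else 0)"
    unfolding cinner_def by (intro sum.cong) (auto simp: axis_def)
  then show ?thesis by simp
qed

lemma norm_vector_scalar_mult: "norm (c *s x) = norm c * norm (x :: complex^'m)"
  by (simp add: norm_vec_def L2_set_right_distrib norm_mult)

lemma conj_transpose_nth [simp]: "conj_transpose A $ i $ j = cnj (A $ j $ i)"
  by (simp add: conj_transpose_def)

lemma conj_transpose_simps [simp]: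
  "conj_transpose (conj_transpose A) = A" "conj_transpose (mat 1) = mat 1"
  by (simp_all add: vec_eq_iff mat_def)

lemma conj_transpose_mult: "conj_transpose (A ** B) = conj_transpose B ** conj_transpose A"
  by (simp add: vec_eq_iff matrix_matrix_mult_def mult.commute)

lemma det_conj_transpose: "det (conj_transpose A) = cnj (det A)"
proof -
  have "det (conj_transpose A) = det (transpose (conj_transpose A))" by (simp add: det_transpose)
  also have "\<dots> = cnj (det A)"
    by (simp add: det_def transpose_def)
  finally show ?thesis .
qed

lemma cinner_adjoint: "cinner x (A *v y) = cinner (conj_transpose A *v x) y"
proof -
  have "cinner x (A *v y) = (\<Sum>i\<in>UNIV. \<Sum>j\<in>UNIV. cnj (x $ i) * (A $ i $ j * y $ j))"
    by (simp add: cinner_def matrix_vector_mult_def sum_distrib_left)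
  also have "\<dots> = (\<Sum>j\<in>UNIV. \<Sum>i\<in>UNIV. cnj (x $ i) * (A $ i $ j * y $ j))"
    by (rule sum.swap)
  also have "\<dots> = cinner (conj_transpose A *v x) y"
    by (simp add: cinner_def matrix_vector_mult_def sum_distrib_left mult_ac)
  finally show ?thesis .
qed

lemma hermitian_cinner: "hermitian_mat A \<Longrightarrow> cinner (A *v x) y = cinner x (A *v y)"
  by (simp add: cinner_adjoint hermitian_mat_def)

lemma hermitian_mat_nth: "hermitian_mat A \<longleftrightarrow> (\<forall>i j. cnj (A $ j $ i) = A $ i $ j)"
  by (auto simp: hermitian_mat_def vec_eq_iff)

lemma hermitian_congruence: "hermitian_mat A \<Longrightarrow> hermitian_mat (conj_transpose G ** A ** G)"
  by (simp add: hermitian_mat_def conj_transpose_mult matrix_mul_assoc)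

lemma hermitian_add_scalar: "hermitian_mat A \<Longrightarrow> hermitian_mat (A + mat (of_real r))"
  by (auto simp: hermitian_mat_nth mat_def)

lemma mat_mult_vec: "mat c *v x = c *s (x :: 'a::semiring_1^'m)"
proof -
  have "(\<Sum>j\<in>UNIV. (if i = j then c else 0) * x $ j) = c * x $ i" for i
  proof -
    have "(\<Sum>j\<in>UNIV. (if i = j then c else 0) * x $ j) = (\<Sum>j\<in>UNIV. if j = i then c * x $ j else 0)"
      by (intro sum.cong) auto
    then show ?thesis by simp
  qed
  then show ?thesis by (simp add: vec_eq_iff matrix_vector_mult_def mat_def)
qed

text \<open>
  A set of indices \<open>S\<close> is carried along so that an eigenbasis can be built one vector at a time.
\<close>

definition eigenbasis_on :: "'i set \<Rightarrow> complex^'m^'m \<Rightarrow> ('i \<Rightarrow> complex^'m) \<Rightarrow> ('i \<Rightarrow> real) \<Rightarrow> bool"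
  where "eigenbasis_on S A v l \<longleftrightarrow>
    (\<forall>i\<in>S. A *v v i = complex_of_real (l i) *s v i \<and>
      (\<forall>j\<in>S. cinner (v i) (v j) = (if i = j then 1 else 0)))"

text \<open>
  The linear term dominates near \<open>t = 0\<close>: this is the first-order condition at a maximum.
\<close>

lemma linear_bound_zero:
  fixes b c :: real
  assumes "\<And>t. 0 \<le> 2 * t * b + t\<^sup>2 * c" shows "b = 0"
proof (rule ccontr)
  assume b: "b \<noteq> 0"
  (* The test point t = - b / k makes the quadratic negative as soon as k > 0 and c < 2 k. *)
  define k where "k = \<bar>c\<bar> + 1"
  have k: "k > 0" "c < k" unfolding k_def by auto
  have "2 * (- b / k) * b + (- b / k)\<^sup>2 * c = (b\<^sup>2 / k\<^sup>2) * (c - 2 * k)"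
    using k by (simp add: power2_eq_square field_simps)
  also have "\<dots> < 0" using b k by (intro mult_pos_neg) auto
  finally show False using assms[of "- b / k"] by simp
qed

text \<open>
  A maximizer \<open>x\<close> of the Rayleigh quotient on the unit sphere of \<open>W\<close> is an eigenvector. With the maximal value
  \<open>f x\<close>, the form of \<open>f x I - A\<close> is nonnegative on \<open>W\<close> and vanishes at \<open>x\<close>, so its first variation at \<open>x\<close> in the
  direction \<open>b = f x x - A x\<close>, which is \<open>2 |b|\<^sup>2\<close>, vanishes.
\<close>

lemma eigenvector_in_invariant_subspace:
  fixes A :: "complex^'m^'m"
  assumes A: "hermitian_mat A"
    and W: "closed W" "\<And>x y. x \<in> W \<Longrightarrow> y \<in> W \<Longrightarrow> x + y \<in> W" "\<And>c x. x \<in> W \<Longrightarrow> c *s x \<in> W"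
    and inv: "\<And>x. x \<in> W \<Longrightarrow> A *v x \<in> W"
    and nz: "x0 \<in> W" "x0 \<noteq> 0"
  shows "\<exists>x\<in>W. \<exists>l. norm x = 1 \<and> A *v x = complex_of_real l *s x"
proof -
  define f where "f x = Re (cinner x (A *v x))" for x
  have fscal: "f (complex_of_real r *s x) = r\<^sup>2 * f x" for r x
    by (simp add: f_def vec.scale power2_eq_square mult_ac)
  have comp: "compact (W \<inter> sphere 0 1)"
    using W(1) by (simp add: closed_Int_compact)
  have "complex_of_real (1 / norm x0) *s x0 \<in> W \<inter> sphere 0 1"
    using nz W(3) by (simp add: norm_vector_scalar_mult del: of_real_divide)
  then have ne: "W \<inter> sphere 0 1 \<noteq> {}" by blast
  have cont: "continuous_on (W \<inter> sphere 0 1) f"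
    unfolding f_def cinner_def matrix_vector_mult_def
    by (intro continuous_intros)
  from continuous_attains_sup[OF comp ne cont]
  obtain x where x: "x \<in> W" "norm x = 1" and max: "\<And>y. y \<in> W \<Longrightarrow> norm y = 1 \<Longrightarrow> f y \<le> f x"
    by auto
  have bound: "f y \<le> f x * (norm y)\<^sup>2" if "y \<in> W" for y
  proof (cases "y = 0")
    case False
    have "f (complex_of_real (1 / norm y) *s y) \<le> f x"
      using False that W(3) by (intro max) (auto simp: norm_vector_scalar_mult simp del: of_real_divide)
    then show ?thesis using False unfolding fscal by (simp add: field_simps)
  qed (simp add: f_def)
  define b where "b = complex_of_real (f x) *s x - A *v x"
  have "b = complex_of_real (f x) *s x + (-1) *s (A *v x)" by (simp add: b_def)
  then have bW: "b \<in> W" using x W inv by metis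
  define c where "c = f x * (norm b)\<^sup>2 - f b"
  have cross: "Re (cinner b (complex_of_real (f x) *s x - A *v x)) = (norm b)\<^sup>2"
    using cinner_self[of b] by (simp add: b_def)
  have "0 \<le> 2 * t * (norm b)\<^sup>2 + t\<^sup>2 * c" for t
  proof -
    let ?y = "x + complex_of_real t *s b"
    have "0 \<le> f x * (norm ?y)\<^sup>2 - f ?y"
      using bound[of ?y] x bW W by simp
    also have "(norm ?y)\<^sup>2 = Re (cinner ?y ?y)" by (simp add: cinner_self)
    also have "Re (cinner ?y ?y) = 1 + 2 * t * Re (cinner b x) + t\<^sup>2 * (norm b)\<^sup>2"
    proof -
      have "Re (cinner x b) = Re (cinner b x)" by (rule Re_cinner_commute)
      moreover have "Re (cinner x x) = 1" "Re (cinner b b) = (norm b)\<^sup>2"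
        using x by (simp_all add: cinner_self)
      ultimately show ?thesis
        by (simp add: power2_eq_square algebra_simps)
    qed
    also have "f ?y = f x + 2 * t * Re (cinner b (A *v x)) + t\<^sup>2 * f b"
    proof -
      have "Re (cinner x (A *v b)) = Re (cinner b (A *v x))"
        using hermitian_cinner[OF A, of x b] Re_cinner_commute by metis
      then show ?thesis
        by (simp add: f_def matrix_vector_right_distrib vec.scale power2_eq_square algebra_simps)
    qed
    finally have "0 \<le> f x * (1 + 2 * t * Re (cinner b x) + t\<^sup>2 * (norm b)\<^sup>2)
        - (f x + 2 * t * Re (cinner b (A *v x)) + t\<^sup>2 * f b)" .
    moreover have "Re (cinner b (A *v x)) = f x * Re (cinner b x) - (norm b)\<^sup>2"
      using cross by simp
    ultimately show ?thesis by (simp only: c_def) (simp add: algebra_simps)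
  qed
  then have "(norm b)\<^sup>2 = 0" by (rule linear_bound_zero)
  then have "A *v x = complex_of_real (f x) *s x" by (simp add: b_def)
  then show ?thesis using x by blast
qed

text \<open>
  The spectral theorem. As long as fewer than \<open>m\<close> eigenvectors have been found, their orthogonal complement is
  nonzero, and it is invariant because the matrix is hermitian.
\<close>

lemma eigenbasis_on_exists:
  fixes A :: "complex^'m^'m" and S :: "'m set"
  assumes A: "hermitian_mat A"
  shows "\<exists>v l. eigenbasis_on S A v l"
proof -
  have "finite S" by simp
  then show ?thesis
  proof (induction S rule: finite_induct)
    case empty
    then show ?case by (simp add: eigenbasis_on_def)
  next
    case (insert i0 S)
    then obtain v l where vl: "eigenbasis_on S A v l" by blast
    define W where "W = {x. \<forall>i\<in>S. cinner (v i) x = 0}"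
    have "card S < card (UNIV :: 'm set)"
      using insert by (intro psubset_card_mono) auto
    from underdetermined_system[OF _ _ this, of "\<lambda>i j. cnj (v i $ j)"]
    obtain x where x: "\<exists>j. x j \<noteq> 0" "\<forall>i\<in>S. (\<Sum>j\<in>UNIV. cnj (v i $ j) * x j) = 0" by auto
    have x0: "(\<chi> j. x j) \<in> W" "(\<chi> j. x j) \<noteq> 0"
      using x by (auto simp: W_def cinner_def vec_eq_iff)
    have "W = (\<Inter>i\<in>S. {x. cinner (v i) x = 0})" by (auto simp: W_def)
    then have "closed W"
      unfolding cinner_def by (auto intro!: closed_INT closed_Collect_eq continuous_intros)
    moreover have "A *v x \<in> W" if "x \<in> W" for x
      unfolding W_def
    proof safe
      fix i assume i: "i \<in> S"
      have "cinner (v i) (A *v x) = cinner (A *v v i) x" by (simp add: hermitian_cinner[OF A])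
      also have "\<dots> = 0" using vl i that by (simp add: eigenbasis_on_def W_def)
      finally show "cinner (v i) (A *v x) = 0" .
    qed
    moreover have "x + y \<in> W" "c *s x \<in> W" if "x \<in> W" "y \<in> W" for x y c
      using that by (auto simp: W_def)
    ultimately obtain y k where y: "y \<in> W" "norm y = 1" "A *v y = complex_of_real k *s y"
      using eigenvector_in_invariant_subspace[OF A, of W] x0 by metis
    have "cinner y (v i) = 0" if "i \<in> S" for i
      using y(1) that by (metis (mono_tags, lifting) W_def cnj_cinner complex_cnj_zero mem_Collect_eq)
    moreover have "cinner y y = 1" using y by (simp add: cinner_self)
    ultimately have "eigenbasis_on (insert i0 S) A (v(i0 := y)) (l(i0 := k))"
      using vl y insert by (auto simp: eigenbasis_on_def W_def)
    then show ?case by blast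
  qed
qed

abbreviation eigenbasis :: "complex^'m^'m \<Rightarrow> ('m \<Rightarrow> complex^'m) \<Rightarrow> ('m \<Rightarrow> real) \<Rightarrow> bool"
  where "eigenbasis \<equiv> eigenbasis_on UNIV"

text \<open>
  In eigencoordinates the quadratic form is diagonal. Partial sums over \<open>I\<close> are needed because the form is
  compared on the spans of the positive and of the nonpositive eigenvectors.
\<close>

lemma cinner_eigenbasis_combination:
  assumes "eigenbasis A v l"
  shows "cinner (\<Sum>i\<in>I. c i *s v i) (A *v (\<Sum>i\<in>I. c i *s v i))
         = complex_of_real (\<Sum>i\<in>I. l i * (norm (c i))\<^sup>2)" (is ?q)
    and "(norm (\<Sum>i\<in>I. c i *s v i))\<^sup>2 = (\<Sum>i\<in>I. (norm (c i))\<^sup>2)" (is ?n)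
proof -
  have orth: "cinner (v i) (v j) = (if i = j then 1 else 0)" for i j
    using assms by (simp add: eigenbasis_on_def)
  have gen: "cinner (\<Sum>i\<in>I. c i *s v i) (\<Sum>i\<in>I. r i *s (c i *s v i))
        = (\<Sum>i\<in>I. r i * complex_of_real ((norm (c i))\<^sup>2))" for r
  proof -
    have "cinner (\<Sum>i\<in>I. c i *s v i) (\<Sum>i\<in>I. r i *s (c i *s v i))
        = (\<Sum>i\<in>I. \<Sum>j\<in>I. if i = j then cnj (c i) * (r j * c j) else 0)"
      unfolding cinner_sum_left cinner_sum_right by (intro sum.cong) (auto simp: orth)
    also have "\<dots> = (\<Sum>i\<in>I. cnj (c i) * (r i * c i))"
      by (intro sum.cong refl) (simp add: sum.delta)
    also have "\<dots> = (\<Sum>i\<in>I. r i * complex_of_real ((norm (c i))\<^sup>2))"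
      by (intro sum.cong refl) (simp add: complex_norm_square mult_ac del: of_real_power)
    finally show ?thesis .
  qed
  have "A *v (\<Sum>i\<in>I. c i *s v i) = (\<Sum>i\<in>I. complex_of_real (l i) *s (c i *s v i))"
    using assms by (simp add: vec.sum vec.scale eigenbasis_on_def mult.commute)
  then show ?q using gen[of "\<lambda>i. complex_of_real (l i)"] by simp
  have "complex_of_real ((norm (\<Sum>i\<in>I. c i *s v i))\<^sup>2) = complex_of_real (\<Sum>i\<in>I. (norm (c i))\<^sup>2)"
    using gen[of "\<lambda>_. 1"] by (simp add: cinner_self)
  then show ?n by (simp only: of_real_eq_iff)
qed


section \<open>Eigenvalue counts and local constancy of the signature\<close>

definition column_matrix :: "('m \<Rightarrow> 'a^'m) \<Rightarrow> 'a^'m^'m" where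
  "column_matrix v = (\<chi> i j. v j $ i)"

definition diagonal_matrix :: "('m \<Rightarrow> 'a::zero) \<Rightarrow> 'a^'m^'m" where
  "diagonal_matrix d = (\<chi> i j. if i = j then d i else 0)"

lemma det_diagonal_matrix: "det (diagonal_matrix d) = (\<Prod>i\<in>UNIV. d i)"
  by (subst det_diagonal) (auto simp: diagonal_matrix_def)

text \<open>
  The Gram matrix of the form of \<open>A\<close> with respect to the columns \<open>v\<close>.
\<close>

lemma congruence_column_matrix:
  "(conj_transpose (column_matrix v) ** A ** column_matrix v) $ i $ j = cinner (v i) (A *v v j)"
proof -
  have "(conj_transpose (column_matrix v) ** A ** column_matrix v) $ i $ j
     = (\<Sum>k\<in>UNIV. \<Sum>l\<in>UNIV. cnj (v i $ k) * (A $ k $ l * v j $ l))"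
    unfolding matrix_mul_assoc[symmetric]
    by (simp add: matrix_matrix_mult_def column_matrix_def sum_distrib_left)
  then show ?thesis by (simp add: cinner_def matrix_vector_mult_def sum_distrib_left)
qed

lemma eigenbasis_congruence:
  assumes "eigenbasis A v l"
  shows "conj_transpose (column_matrix v) ** A ** column_matrix v
      = diagonal_matrix (\<lambda>i. complex_of_real (l i))"
    and "conj_transpose (column_matrix v) ** column_matrix v = mat 1"
proof -
  show "conj_transpose (column_matrix v) ** A ** column_matrix v
      = diagonal_matrix (\<lambda>i. complex_of_real (l i))"
    unfolding vec_eq_iff congruence_column_matrix
    using assms by (auto simp: eigenbasis_on_def diagonal_matrix_def)
  have "(mat 1 :: complex^'a^'a) $ i $ j = (if i = j then 1 else 0)" for i j
    by (simp add: mat_def)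
  then have "conj_transpose (column_matrix v) ** mat 1 ** column_matrix v = mat 1"
    unfolding vec_eq_iff congruence_column_matrix
    using assms by (auto simp: eigenbasis_on_def)
  then show "conj_transpose (column_matrix v) ** column_matrix v = mat 1" by simp
qed

lemma charpoly_eigenbasis:
  assumes "eigenbasis A v l"
  shows "charpoly A = (\<Prod>i\<in>UNIV. [:- complex_of_real (l i), 1:])"
proof -
  let ?U = "column_matrix v"
  have "det (conj_transpose ?U) * det ?U = 1"
    using eigenbasis_congruence(2)[OF assms] by (metis det_I det_mul)
  have "poly (charpoly A) x = poly (\<Prod>i\<in>UNIV. [:- complex_of_real (l i), 1:]) x" for x
  proof -
    have "conj_transpose ?U ** (mat x - A) ** ?U = diagonal_matrix (\<lambda>i. x - complex_of_real (l i))"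
      unfolding vec_eq_iff congruence_column_matrix
      using assms
      by (auto simp: matrix_vector_mult_diff_rdistrib mat_mult_vec eigenbasis_on_def
          diagonal_matrix_def)
    then have "det (conj_transpose ?U) * det (mat x - A) * det ?U = (\<Prod>i\<in>UNIV. x - complex_of_real (l i))"
      by (metis det_mul det_diagonal_matrix)
    moreover have "det (conj_transpose ?U) * det (mat x - A) * det ?U =
      (det (conj_transpose ?U) * det ?U) * det (mat x - A)" by (simp only: mult_ac)
    ultimately show ?thesis using \<open>_ = 1\<close> by (simp add: poly_charpoly poly_prod)
  qed
  then show ?thesis using poly_eq_poly_eq_iff by blast
qed

lemma order_prod_linear:
  fixes c :: "'i \<Rightarrow> 'a::field"
  assumes "finite S"
  shows "order a (\<Prod>i\<in>S. [:- c i, 1:]) = card {i\<in>S. c i = a}"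
  using assms
proof (induction S rule: finite_induct)
  case (insert i S)
  have nz: "(\<Prod>i\<in>insert i S. [:- c i, 1:]) \<noteq> 0" using insert by (simp add: prod_zero_iff del: mult_pCons_left)
  have one: "order a [:- c i, 1:] = (if c i = a then 1 else 0)"
    using order_power_n_n[of a 1] by (auto intro!: order_0I)
  have "{j\<in>insert i S. c j = a} = (if c i = a then insert i {j\<in>S. c j = a} else {j\<in>S. c j = a})"
    by auto
  then have "card {j\<in>insert i S. c j = a} = order a [:- c i, 1:] + card {j\<in>S. c j = a}"
    using insert one by auto
  moreover have "order a (\<Prod>i\<in>insert i S. [:- c i, 1:]) = order a [:- c i, 1:] + order a (\<Prod>i\<in>S. [:- c i, 1:])"
    using order_mult[OF nz[unfolded prod.insert[OF insert(1,2)]]]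
    unfolding prod.insert[OF insert(1,2)] .
  ultimately show ?case using insert by simp
qed (simp add: order_0I)

text \<open>
  The multiplicity of a root of the characteristic polynomial is the number of indices of an eigenbasis that
  carry this eigenvalue, so counting roots amounts to counting indices.
\<close>

lemma sum_order_charpoly:
  assumes "eigenbasis A v l"
  shows "(\<Sum>x | P x \<and> poly (charpoly A) (complex_of_real x) = 0. order (complex_of_real x) (charpoly A))
     = card {i. P (l i)}"
proof -
  have "{x. P x \<and> poly (charpoly A) (complex_of_real x) = 0} = l ` {i. P (l i)}"
    by (auto simp: charpoly_eigenbasis[OF assms] poly_prod)
  moreover have "card {i. P (l i)} = (\<Sum>x\<in>l ` {i. P (l i)}. card {i. i \<in> {i. P (l i)} \<and> l i = x})"
    using sum.image_gen[of "{i. P (l i)}" "\<lambda>_. 1::nat" l] by simp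
  ultimately show ?thesis
    by (auto simp: charpoly_eigenbasis[OF assms] order_prod_linear intro!: sum.cong arg_cong[of _ _ card])
qed

lemma signature_eigenbasis:
  assumes "eigenbasis A v l"
  shows "signature A = (card {i. 0 < l i}, card {i. l i < 0})"
  using sum_order_charpoly[OF assms, of "\<lambda>x. 0 < x"] sum_order_charpoly[OF assms, of "\<lambda>x. x < 0"]
  by (simp add: signature_def num_pos_eigenvalues_def num_neg_eigenvalues_def)

lemma eigenbasis_nonzero:
  fixes A :: "complex^'m^'m"
  assumes "eigenbasis A v l" "det A \<noteq> 0"
  shows "l i \<noteq> 0"
proof
  assume "l i = 0"
  then have "poly (charpoly A) 0 = 0"
    unfolding charpoly_eigenbasis[OF assms(1)] poly_prod by (auto simp: prod_zero_iff)
  then have "det (- A) = 0" by (simp add: poly_charpoly)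
  moreover have "- A = mat (-1) ** A"
    by (simp add: vec_eq_iff matrix_matrix_mult_def mat_def if_distrib[of "\<lambda>x. x * _"] cong: if_cong)
  moreover have "det (mat (-1) :: complex^'m^'m) \<noteq> 0"
    by (subst det_diagonal) (auto simp: mat_def)
  ultimately show False using assms(2) by (simp add: det_mul)
qed

lemma signature_sum:
  assumes "hermitian_mat (A :: complex^'m^'m)" "det A \<noteq> 0"
  shows "fst (signature A) + snd (signature A) = CARD('m)"
proof -
  obtain v l where vl: "eigenbasis A v l" using eigenbasis_on_exists[OF assms(1)] by blast
  have "UNIV = {i. 0 < l i} \<union> {i. l i < 0}"
    using eigenbasis_nonzero[OF vl assms(2)] by (auto simp: neq_iff)
  then have "CARD('m) = card {i. 0 < l i} + card {i. l i < 0}"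
    by (metis (no_types, lifting) card_Un_disjoint disjoint_iff finite mem_Collect_eq order_less_asym)
  then show ?thesis by (simp add: signature_eigenbasis[OF vl])
qed

text \<open>
  If \<open>B\<close> had fewer positive eigenvalues than \<open>A\<close>, then the positive eigenspace of \<open>A\<close> and the nonpositive
  eigenspace of \<open>B\<close> would have dimensions adding up to more than \<open>m\<close>. On a common nonzero vector the form of \<open>A\<close>
  exceeds \<open>c\<close> times the squared norm while the form of \<open>B\<close> is at most \<open>0\<close>, although the two differ by at most
  \<open>c\<close> times the squared norm.
\<close>

lemma card_positive_le:
  fixes A B :: "complex^'m^'m"
  assumes A: "eigenbasis A v l" and B: "eigenbasis B w k"
    and gap: "\<And>i. 0 < l i \<Longrightarrow> c < l i"
    and close: "\<And>x. \<bar>Re (cinner x ((B - A) *v x))\<bar> \<le> c * (norm x)\<^sup>2"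
  shows "card {i. 0 < l i} \<le> card {i. 0 < k i}"
proof (rule ccontr)
  assume less: "\<not> ?thesis"
  define P where "P = {i. 0 < l i}"
  define N where "N = {i. k i \<le> 0}"
  have "N = UNIV - {i. 0 < k i}" by (auto simp: N_def)
  then have "card N = CARD('m) - card {i. 0 < k i}" by (simp add: card_Diff_subset)
  moreover have "card {i. 0 < k i} \<le> CARD('m)" by (intro card_mono) auto
  ultimately have "CARD('m) < card (P <+> N)" using less by (simp add: card_Plus P_def)
  then obtain x where x: "\<exists>j\<in>P <+> N. x j \<noteq> 0"
      "\<And>i. (\<Sum>j\<in>P <+> N. (case j of Inl j \<Rightarrow> v j | Inr j \<Rightarrow> w j) $ i * x j) = 0"
    using underdetermined_system[of UNIV "P <+> N"
        "\<lambda>i j. (case j of Inl j \<Rightarrow> v j | Inr j \<Rightarrow> w j) $ i"] by auto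
  define y where "y = (\<Sum>i\<in>P. x (Inl i) *s v i)"
  have "y + (\<Sum>j\<in>N. x (Inr j) *s w j) = 0"
    using x(2) by (simp add: y_def vec_eq_iff sum.Plus mult.commute)
  then have y: "y = (\<Sum>j\<in>N. (- x (Inr j)) *s w j)"
    by (simp add: eq_neg_iff_add_eq_0 sum_negf)
  have ny: "(norm y)\<^sup>2 = (\<Sum>i\<in>P. (norm (x (Inl i)))\<^sup>2)"
    unfolding y_def by (rule cinner_eigenbasis_combination(2)[OF A])
  have ny': "(norm y)\<^sup>2 = (\<Sum>i\<in>N. (norm (x (Inr i)))\<^sup>2)"
    unfolding y using cinner_eigenbasis_combination(2)[OF B, where I = N and c = "\<lambda>j. - x (Inr j)"] by simp
  have "y \<noteq> 0"
  proof
    assume "y = 0"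
    then have "\<forall>i\<in>P. x (Inl i) = 0" "\<forall>i\<in>N. x (Inr i) = 0"
      using ny ny' by (auto simp: sum_nonneg_eq_0_iff eq_commute[of 0])
    then show False using x(1) by auto
  qed
  have qA: "Re (cinner y (A *v y)) = (\<Sum>i\<in>P. l i * (norm (x (Inl i)))\<^sup>2)"
    using cinner_eigenbasis_combination(1)[OF A, where I = P and c = "\<lambda>i. x (Inl i)"] unfolding y_def[symmetric] by simp
  have "c * (norm y)\<^sup>2 < Re (cinner y (A *v y))"
  proof -
    have "y = 0" if "\<forall>i\<in>P. x (Inl i) = 0" using that by (simp add: y_def)
    with \<open>y \<noteq> 0\<close> obtain i where i: "i \<in> P" "x (Inl i) \<noteq> 0" by blast
    have lt: "c < l j" if "j \<in> P" for j using that gap by (simp add: P_def)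
    show ?thesis unfolding qA ny sum_distrib_left
    proof (intro sum_strict_mono_ex1 ballI bexI[of _ i])
      show "c * (norm (x (Inl j)))\<^sup>2 \<le> l j * (norm (x (Inl j)))\<^sup>2" if "j \<in> P" for j
        using lt[OF that] by (intro mult_right_mono) auto
      show "c * (norm (x (Inl i)))\<^sup>2 < l i * (norm (x (Inl i)))\<^sup>2"
        using i lt[OF i(1)] by (intro mult_strict_right_mono) auto
    qed (use i in auto)
  qed
  moreover have "Re (cinner y (B *v y)) \<le> 0"
    using cinner_eigenbasis_combination(1)[OF B, where I = N and c = "\<lambda>i. - x (Inr i)"] unfolding y[symmetric]
    by (auto simp: N_def intro!: sum_nonpos mult_nonpos_nonneg)
  moreover have "Re (cinner y (B *v y)) = Re (cinner y (A *v y)) + Re (cinner y ((B - A) *v y))"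
    by (simp add: matrix_vector_mult_diff_rdistrib)
  ultimately show False using close[of y] by linarith
qed

lemma cinner_matrix_bound:
  fixes C :: "complex^'m^'m"
  shows "\<bar>Re (cinner x (C *v x))\<bar> \<le> (real CARD('m))\<^sup>2 * norm C * (norm x)\<^sup>2"
proof -
  have "\<bar>Re (cinner x (C *v x))\<bar> \<le> norm (cinner x (C *v x))" by (rule abs_Re_le_cmod)
  also have "\<dots> = norm (\<Sum>i\<in>UNIV. \<Sum>j\<in>UNIV. cnj (x $ i) * (C $ i $ j * x $ j))"
    by (simp add: cinner_def matrix_vector_mult_def sum_distrib_left)
  also have "\<dots> \<le> (\<Sum>i\<in>(UNIV::'m set). \<Sum>j\<in>(UNIV::'m set). norm C * (norm x)\<^sup>2)"
  proof (intro sum_norm_le)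
    fix i j
    have "norm (C $ i $ j) \<le> norm C" by (meson Finite_Cartesian_Product.norm_nth_le order_trans)
    then have "norm (x $ i) * (norm (C $ i $ j) * norm (x $ j)) \<le> norm x * (norm C * norm x)"
      by (intro mult_mono Finite_Cartesian_Product.norm_nth_le) auto
    then show "norm (cnj (x $ i) * (C $ i $ j * x $ j)) \<le> norm C * (norm x)\<^sup>2"
      by (simp add: norm_mult power2_eq_square mult_ac)
  qed
  finally show ?thesis by (simp add: power2_eq_square)
qed

lemma matrix_vector_mult_minus: "(- A) *v x = - (A *v x)" for A :: "complex^'m^'n"
  using matrix_vector_mult_diff_rdistrib[of 0 A x] by simp

lemma eigenbasis_uminus: "eigenbasis A v l \<Longrightarrow> eigenbasis (- A) v (\<lambda>i. - l i)"
  by (simp add: eigenbasis_on_def matrix_vector_mult_minus)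

text \<open>
  Neither the number of positive nor the number of negative eigenvalues can drop under a small perturbation, and
  their sum is \<open>m\<close> as long as the matrix is invertible.
\<close>

lemma signature_locally_constant:
  fixes A :: "complex^'m^'m"
  assumes A: "hermitian_mat A" "det A \<noteq> 0"
  shows "\<exists>e>0. \<forall>B. hermitian_mat B \<and> det B \<noteq> 0 \<and> dist B A < e \<longrightarrow> signature B = signature A"
proof -
  obtain v l where vl: "eigenbasis A v l" using eigenbasis_on_exists[OF A(1)] by blast
  (* Half of the spectral gap, so that c < |l i| holds strictly. *)
  define c where "c = Min (range (\<lambda>i. \<bar>l i\<bar>)) / 2"
  have "0 < Min (range (\<lambda>i. \<bar>l i\<bar>))"
    using eigenbasis_nonzero[OF vl A(2)] by (subst Min_gr_iff) auto
  then have "c > 0" "c < Min (range (\<lambda>i. \<bar>l i\<bar>))" by (auto simp: c_def)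
  moreover have "Min (range (\<lambda>i. \<bar>l i\<bar>)) \<le> \<bar>l i\<bar>" for i by (intro Min_le) auto
  ultimately have c: "c > 0" "\<And>i. c < \<bar>l i\<bar>" by (auto intro: less_le_trans)
  show ?thesis
  proof (intro exI[of _ "c / (real CARD('m))\<^sup>2"] conjI allI impI)
    show "0 < c / (real CARD('m))\<^sup>2" using c by simp
    fix B :: "complex^'m^'m"
    assume B: "hermitian_mat B \<and> det B \<noteq> 0 \<and> dist B A < c / (real CARD('m))\<^sup>2"
    then obtain w k where wk: "eigenbasis B w k" using eigenbasis_on_exists by blast
    have nc: "(real CARD('m))\<^sup>2 * norm (B - A) \<le> c"
      using B by (simp add: dist_norm field_simps)
    have close: "\<bar>Re (cinner x ((B - A) *v x))\<bar> \<le> c * (norm x)\<^sup>2" for x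
      using cinner_matrix_bound[of x "B - A"] mult_right_mono[OF nc, of "(norm x)\<^sup>2"] by simp
    have p: "card {i. 0 < l i} \<le> card {i. 0 < k i}"
      using c(2) by (intro card_positive_le[OF vl wk _ close]) (metis abs_of_pos)
    have close': "\<bar>Re (cinner x ((- B - (- A)) *v x))\<bar> \<le> c * (norm x)\<^sup>2" for x
      using close[of x] matrix_vector_mult_minus[of "B - A" x] by (simp add: minus_diff_commute)
    have "card {i. 0 < - l i} \<le> card {i. 0 < - k i}"
      using c(2) by (intro card_positive_le[OF eigenbasis_uminus[OF vl] eigenbasis_uminus[OF wk] _ close'])
        (metis abs_minus_cancel abs_of_pos)
    moreover have "fst (signature B) + snd (signature B) = fst (signature A) + snd (signature A)"
      using signature_sum A B by metis
    ultimately show "signature B = signature A"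
      using p by (simp add: signature_eigenbasis[OF vl] signature_eigenbasis[OF wk])
  qed
qed

lemma signature_constant_on_connected:
  fixes f :: "'a::topological_space \<Rightarrow> complex^'m^'m"
  assumes S: "connected S" and f: "continuous_on S f"
    and inv: "\<And>x. x \<in> S \<Longrightarrow> hermitian_mat (f x) \<and> det (f x) \<noteq> 0"
    and xy: "x \<in> S" "y \<in> S"
  shows "signature (f x) = signature (f y)"
proof (rule connected_local_const[OF S xy, where f = "\<lambda>x. signature (f x)"], rule ballI)
  fix x assume x: "x \<in> S"
  obtain e where e: "e > 0" "\<And>B. hermitian_mat B \<and> det B \<noteq> 0 \<and> dist B (f x) < e \<Longrightarrow> signature B = signature (f x)"
    using signature_locally_constant inv[OF x] by metis
  have "(f \<longlongrightarrow> f x) (at x within S)" using f x by (simp add: continuous_on)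
  then have "eventually (\<lambda>y. dist (f y) (f x) < e) (at x within S)"
    using e(1) by (rule tendstoD)
  moreover have "eventually (\<lambda>y. y \<in> S) (at x within S)"
    by (simp add: eventually_at_filter)
  ultimately show "eventually (\<lambda>y. signature (f x) = signature (f y)) (at x within S)"
    by eventually_elim (use e(2) inv in metis)
qed


section \<open>Sylvester normal form and paths of invertible matrices\<close>

text \<open>
  The determinant on the complex line through \<open>I\<close> and \<open>V\<close> is a nonzero polynomial, and the complement of its
  finitely many zeros in the complex plane is path-connected.
\<close>

lemma det_nonzero_path_from_identity:
  fixes V :: "complex^'m^'m"
  assumes "det V \<noteq> 0"
  shows "\<exists>\<gamma>. continuous_on {0..1::real} \<gamma> \<and> \<gamma> 0 = mat 1 \<and> \<gamma> 1 = V \<and> (\<forall>t\<in>{0..1}. det (\<gamma> t) \<noteq> 0)"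
proof -
  define f where "f s = (\<chi> i j. mat 1 $ i $ j + s * (V $ i $ j - mat 1 $ i $ j))" for s :: complex
  define p where "p = det (\<chi> i j. [:mat 1 $ i $ j, V $ i $ j - mat 1 $ i $ j:])"
  have p: "poly p s = det (f s)" for s
    by (simp add: p_def f_def det_def poly_sum poly_prod flip: of_int_poly)
  have f01: "f 0 = mat 1" "f 1 = V" by (simp_all add: f_def vec_eq_iff)
  then have "p \<noteq> 0" using p[of 0] by auto
  then have "countable {s. poly p s = 0}" using poly_roots_finite countable_finite by blast
  then have "path_connected (- {s. poly p s = 0})"
    by (intro path_connected_complement_countable) auto
  moreover have "0 \<in> - {s. poly p s = 0}" "1 \<in> - {s. poly p s = 0}"
    using assms by (auto simp: p f01)
  ultimately obtain g where g: "path g" "path_image g \<subseteq> - {s. poly p s = 0}"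
      "pathstart g = 0" "pathfinish g = 1"
    unfolding path_connected_def by metis
  show ?thesis
  proof (intro exI[of _ "f \<circ> g"] conjI ballI)
    show "continuous_on {0..1} (f \<circ> g)"
      using g(1) unfolding path_def f_def o_def by (intro continuous_intros)
    show "det ((f \<circ> g) t) \<noteq> 0" if "t \<in> {0..1}" for t
    proof -
      have "g t \<in> path_image g" using that by (simp add: path_image_def)
      then show ?thesis using g(2) by (auto simp: p[symmetric])
    qed
  qed (use g f01 in \<open>auto simp: pathstart_def pathfinish_def\<close>)
qed

text \<open>
  Sylvester's law: the eigenvectors are rescaled by \<open>|l|\<^sup>-\<^sup>1\<^sup>/\<^sup>2\<close> and permuted so that the positive eigenvalues
  sit at the positions in \<open>P\<close>. Every \<open>P\<close> of the right size is allowed, so that one normal form serves all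
  matrices of a given signature.
\<close>

lemma congruent_to_sign_matrix:
  fixes A :: "complex^'m^'m"
  assumes A: "hermitian_mat A" "det A \<noteq> 0" and P: "fst (signature A) = card P"
  shows "\<exists>V. det V \<noteq> 0 \<and>
    conj_transpose V ** A ** V = diagonal_matrix (\<lambda>i. if i \<in> P then 1 else - 1)"
proof -
  obtain v l where vl: "eigenbasis A v l" using eigenbasis_on_exists[OF A(1)] by blast
  have l: "l i \<noteq> 0" for i by (rule eigenbasis_nonzero[OF vl A(2)])
  define L where "L = {i. 0 < l i}"
  have "card P = card L" using P by (simp add: signature_eigenbasis[OF vl] L_def)
  moreover have "card (- P) = card (- L)" using calculation by (simp add: Compl_eq_Diff_UNIV card_Diff_subset)
  ultimately obtain f g where f: "bij_betw f P L" and g: "bij_betw g (- P) (- L)"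
    by (meson finite finite_same_card_bij)
  define h where "h i = (if i \<in> P then f i else g i)" for i
  have "bij_betw h (P \<union> - P) (L \<union> - L)"
    unfolding h_def using f g by (intro bij_betw_disjoint_Un) auto
  then have inj: "h i = h j \<longleftrightarrow> i = j" for i j by (auto simp: bij_betw_def inj_on_def)
  have pos: "0 < l (h i) \<longleftrightarrow> i \<in> P" for i
    using f g by (auto simp: h_def bij_betw_def L_def)
  define w where "w i = complex_of_real (1 / sqrt \<bar>l (h i)\<bar>) *s v (h i)" for i
  have "conj_transpose (column_matrix w) ** A ** column_matrix w
      = diagonal_matrix (\<lambda>i. if i \<in> P then 1 else - 1)"
    unfolding vec_eq_iff congruence_column_matrix
  proof (intro allI)
    fix i j
    have "cinner (w i) (A *v w j) = complex_of_real (1 / sqrt \<bar>l (h i)\<bar> * (1 / sqrt \<bar>l (h j)\<bar>) * l (h j)) *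
        (if i = j then 1 else 0)"
      using vl by (simp add: w_def vec.scale eigenbasis_on_def inj)
    also have "\<dots> = (if i = j then complex_of_real (l (h i) / \<bar>l (h i)\<bar>) else 0)"
      by (simp add: field_simps flip: real_sqrt_mult)
    also have "l (h i) / \<bar>l (h i)\<bar> = (if i \<in> P then 1 else - 1)"
      using l[of "h i"] pos[of i] by (auto simp: abs_if)
    finally show "cinner (w i) (A *v w j) = diagonal_matrix (\<lambda>i. if i \<in> P then 1 else - 1) $ i $ j"
      by (auto simp: diagonal_matrix_def)
  qed
  moreover have "det (diagonal_matrix (\<lambda>i. if i \<in> P then 1 else - 1 :: complex) :: complex^'m^'m) \<noteq> 0"
    by (simp add: det_diagonal_matrix)
  ultimately show ?thesis by (metis det_mul mult_zero_right)
qed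

lemma signature_sign_matrix:
  "signature (diagonal_matrix (\<lambda>i. if i \<in> P then 1 else - 1) :: complex^'m^'m) = (card P, card (- P))"
proof -
  let ?D = "diagonal_matrix (\<lambda>i. if i \<in> P then 1 else - 1) :: complex^'m^'m"
  have "(\<Sum>k\<in>UNIV. ?D $ j $ k * axis i 1 $ k) = ?D $ j $ i" for i j
  proof -
    have "(\<Sum>k\<in>UNIV. ?D $ j $ k * axis i 1 $ k) = (\<Sum>k\<in>UNIV. if k = i then ?D $ j $ k else 0)"
      by (intro sum.cong) (auto simp: axis_def)
    then show ?thesis by simp
  qed
  then have "?D *v axis i 1 = complex_of_real (if i \<in> P then 1 else - 1) *s axis i 1" for i
    by (auto simp: vec_eq_iff matrix_vector_mult_def) (auto simp: diagonal_matrix_def axis_def)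
  then have "eigenbasis ?D (\<lambda>i. axis i 1) (\<lambda>i. if i \<in> P then 1 else - 1)"
    by (auto simp: eigenbasis_on_def cinner_axis) (auto simp: axis_def)
  from signature_eigenbasis[OF this] show ?thesis
    by (auto intro!: arg_cong[of _ _ card] split: if_splits)
qed


section \<open>Paths in the space of invertible hermitian functions\<close>

abbreviation circle :: "complex set" where
  "circle \<equiv> sphere 0 1"

text \<open>
  Joint continuity on the compact set \<open>[0,1] \<times> circle\<close> is uniform, which is continuity of the path in the
  supremum metric.
\<close>

lemma circle_family_path:
  fixes h :: "real \<Rightarrow> complex \<Rightarrow> complex^'m^'m"
  assumes h: "continuous_on ({0..1} \<times> circle) (\<lambda>x. h (fst x) (snd x))"
    and inv: "\<And>t. t \<in> {0..1} \<Longrightarrow> restrict (h t) circle \<in> herm_inv n"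
  shows "path_component_of (herm_inv_topology n) (restrict (h 0) circle) (restrict (h 1) circle)"
proof -
  let ?C = "cfunspace (top_of_set circle) (euclidean_metric :: (complex^'m^'m) metric)"
  let ?g = "\<lambda>t. restrict (h t) circle"
  have mem: "?g t \<in> mspace ?C" if "t \<in> {0..1}" for t
    using inv[OF that] fejer_riesz_mat_subset_cfunspace by (auto simp: herm_inv_def simp del: mspace_cfunspace)
  have "uniformly_continuous_on ({0..1} \<times> circle) (\<lambda>x. h (fst x) (snd x))"
    by (intro compact_uniformly_continuous h compact_Times) auto
  then have unif: "\<exists>d>0. \<forall>s\<in>{0..1}. \<forall>t\<in>{0..1}. \<forall>z\<in>circle. dist s t < d \<longrightarrow> dist (h s z) (h t z) < e"
    if "e > 0" for e
    using that unfolding uniformly_continuous_on_def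
    by (force simp: dist_Pair_Pair)
  have "uniformly_continuous_map (submetric euclidean_metric {0..1}) ?C ?g"
    unfolding uniformly_continuous_map_def
  proof (intro conjI allI impI)
    show "?g \<in> mspace (submetric euclidean_metric {0..1}) \<rightarrow> mspace ?C"
      using mem by (simp del: mspace_cfunspace)
    fix e :: real assume "e > 0"
    then obtain d where d: "d > 0"
      "\<And>s t z. s \<in> {0..1} \<Longrightarrow> t \<in> {0..1} \<Longrightarrow> z \<in> circle \<Longrightarrow> dist s t < d \<Longrightarrow> dist (h s z) (h t z) < e / 2"
      using unif[of "e / 2"] by auto
    have "mdist ?C (?g s) (?g t) < e" if "s \<in> {0..1}" "t \<in> {0..1}" "dist s t < d" for s t
    proof -
      have "mdist ?C (?g s) (?g t) \<le> e / 2"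
        using d(2)[OF that(1,2) _ that(3)] \<open>e > 0\<close> by (intro mdist_cfunspace_le) (auto intro: less_imp_le)
      then show ?thesis using \<open>e > 0\<close> by simp
    qed
    then show "\<exists>\<delta>>0. \<forall>x\<in>mspace (submetric euclidean_metric {0..1}). \<forall>y\<in>mspace (submetric euclidean_metric {0..1}).
         mdist (submetric euclidean_metric {0..1}) y x < \<delta> \<longrightarrow> mdist ?C (?g y) (?g x) < e"
      using d(1) by (intro exI[of _ d]) auto
  qed
  then have "continuous_map (top_of_set {0..1}) (mtopology_of ?C) ?g"
    using uniformly_continuous_imp_continuous_map by (fastforce simp: mtopology_of_submetric)
  then have "pathin (herm_inv_topology n) ?g"
    using inv unfolding pathin_def herm_inv_topology_def fejer_riesz_topology_def
    by (auto simp: continuous_map_in_subtopology herm_inv_def)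
  then show ?thesis unfolding path_component_of_def by auto
qed

lemma continuous_map_evaluation:
  assumes "z \<in> circle"
  shows "continuous_map (herm_inv_topology n) euclidean (\<lambda>a :: complex \<Rightarrow> complex^'m^'m. a z)"
proof -
  let ?C = "cfunspace (top_of_set circle) (euclidean_metric :: (complex^'m^'m) metric)"
  have "uniformly_continuous_map ?C euclidean_metric (\<lambda>a. a z)"
    unfolding uniformly_continuous_map_def
  proof (intro conjI allI impI)
    fix e :: real assume "e > 0"
    have "dist (b z) (a z) < e" if "a \<in> mspace ?C" "b \<in> mspace ?C" "mdist ?C b a < e" for a b
      using cfunspace_mdist_lt[OF _ that(2,1,3), of z] assms
      by (simp add: compactin_subtopology)
    then show "\<exists>\<delta>>0. \<forall>x\<in>mspace ?C. \<forall>y\<in>mspace ?C. mdist ?C y x < \<delta> \<longrightarrow>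
        mdist euclidean_metric (y z) (x z) < e"
      using \<open>e > 0\<close> by (intro exI[of _ e]) (auto simp del: mspace_cfunspace)
  qed auto
  then have "continuous_map (mtopology_of ?C) euclidean (\<lambda>a. a z)"
    using uniformly_continuous_imp_continuous_map by fastforce
  then show ?thesis
    unfolding herm_inv_topology_def fejer_riesz_topology_def
    by (intro continuous_map_from_subtopology)
qed

lemma signature_path_component:
  fixes a b :: "complex \<Rightarrow> complex^'m^'m"
  assumes "path_component_of (herm_inv_topology n) a b" "z \<in> circle"
  shows "signature (a z) = signature (b z)"
proof -
  obtain g where g: "pathin (herm_inv_topology n) g" "g 0 = a" "g 1 = b"
    using assms(1) by (auto simp: path_component_of_def)
  have cont: "continuous_on {0..1} (\<lambda>t. g t z)"
    using continuous_map_compose[OF g(1)[unfolded pathin_def] continuous_map_evaluation[OF assms(2)]]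
    by (simp add: o_def)
  have "g t \<in> herm_inv n" if "t \<in> {0..1}" for t
    using g(1) that continuous_map_image_subset_topspace[of "top_of_set {0..1}" "herm_inv_topology n" g]
    by (auto simp: pathin_def topspace_herm_inv_topology)
  then have inv: "hermitian_mat (g t z) \<and> det (g t z) \<noteq> 0" if "t \<in> {0..1}" for t
    using that assms(2) by (auto simp: herm_inv_def)
  show ?thesis
    using signature_constant_on_connected[OF _ cont inv, of 0 1] g by simp
qed

lemma continuous_on_fejer_riesz:
  fixes a :: "complex \<Rightarrow> complex^'m^'m"
  assumes "a \<in> fejer_riesz_mat n"
  shows "continuous_on circle a"
  using assms fejer_riesz_mat_subset_cfunspace[of n] by auto

lemma signature_constant_on_circle:
  fixes a :: "complex \<Rightarrow> complex^'m^'m"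
  assumes "a \<in> herm_inv n" "z \<in> circle" "w \<in> circle"
  shows "signature (a z) = signature (a w)"
proof (rule signature_constant_on_connected[of circle a])
  show "connected circle" by (simp add: connected_sphere)
  show "continuous_on circle a" using assms(1) continuous_on_fejer_riesz by (auto simp: herm_inv_def)
qed (use assms in \<open>auto simp: herm_inv_def\<close>)


section \<open>Mean values over the circle\<close>

definition unit_point :: "real \<Rightarrow> complex" where
  "unit_point t = exp (2 * of_real pi * \<i> * of_real t)"

lemma norm_unit_point [simp]: "norm (unit_point t) = 1"
  by (simp add: unit_point_def)

lemma unit_point_in_circle [simp]: "unit_point t \<in> circle"
  by simp

lemma unit_point_surj: "z \<in> circle \<Longrightarrow> \<exists>t\<in>{0..1}. unit_point t = z"
proof -
  assume "z \<in> circle"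
  then have "z \<in> path_image (circlepath 0 1)" by simp
  then show ?thesis by (auto simp: path_image_def circlepath unit_point_def)
qed

lemma continuous_on_unit_point [continuous_intros]: "continuous_on S unit_point"
  unfolding unit_point_def by (intro continuous_intros)

definition mean :: "(complex \<Rightarrow> complex) \<Rightarrow> complex" where
  "mean f = integral {0..1} (\<lambda>t. f (unit_point t))"

lemma continuous_on_comp_unit_point:
  assumes "continuous_on circle f"
  shows "continuous_on S (\<lambda>t. f (unit_point t))"
  using continuous_on_compose2[OF assms continuous_on_unit_point, of S] by (simp add: image_subset_iff)

lemma integrable_comp_unit_point:
  fixes f :: "complex \<Rightarrow> complex"
  shows "continuous_on circle f \<Longrightarrow> (\<lambda>t. f (unit_point t)) integrable_on {0..1}"
  by (intro integrable_continuous_interval continuous_on_comp_unit_point)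

lemma mean_cong: "(\<And>z. z \<in> circle \<Longrightarrow> f z = g z) \<Longrightarrow> mean f = mean g"
  unfolding mean_def by (intro integral_cong) auto

lemma mean_zero [simp]: "mean (\<lambda>z. 0) = 0"
  by (simp add: mean_def)

lemma mean_add:
  "continuous_on circle f \<Longrightarrow> continuous_on circle g \<Longrightarrow> mean (\<lambda>z. f z + g z) = mean f + mean g"
  unfolding mean_def by (intro Henstock_Kurzweil_Integration.integral_add integrable_comp_unit_point)

lemma mean_diff:
  "continuous_on circle f \<Longrightarrow> continuous_on circle g \<Longrightarrow> mean (\<lambda>z. f z - g z) = mean f - mean g"
  unfolding mean_def by (intro integral_diff integrable_comp_unit_point)

lemma mean_cmult: "mean (\<lambda>z. c * f z) = c * mean f"
  unfolding mean_def by simp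

lemma mean_sum:
  "(\<And>i. i \<in> I \<Longrightarrow> continuous_on circle (f i)) \<Longrightarrow> mean (\<lambda>z. \<Sum>i\<in>I. f i z) = (\<Sum>i\<in>I. mean (f i))"
proof (induction I rule: infinite_finite_induct)
  case (insert i I)
  then show ?case by (simp add: mean_add continuous_on_sum)
qed auto

lemma mean_cnj: "mean (\<lambda>z. cnj (f z)) = cnj (mean f)"
  unfolding mean_def by (simp add: integral_cnj)

text \<open>
  Fourier coefficients of a function holomorphic across the circle are its Taylor coefficients at \<open>0\<close>, by
  Cauchy's integral formula for derivatives.
\<close>

lemma mean_inverse_power_holomorphic:
  assumes U: "U holomorphic_on ball 0 \<rho>" and \<rho>: "\<rho> > 1"
  shows "mean (\<lambda>z. U z / z ^ k) = (deriv ^^ k) U 0 / fact k"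
proof -
  have sub: "cball 0 1 \<subseteq> ball (0::complex) \<rho>" using \<rho> by auto
  have "((\<lambda>u. U u / (u - 0) ^ Suc k) has_contour_integral (2 * pi * \<i> / fact k * (deriv ^^ k) U 0)) (circlepath 0 1)"
    using U sub \<rho>
    by (intro Cauchy_has_contour_integral_higher_derivative_circlepath)
      (auto intro: holomorphic_on_imp_continuous_on holomorphic_on_subset)
  then have "((\<lambda>t. U (unit_point t) / unit_point t ^ Suc k * (2 * pi * \<i> * unit_point t)) has_integral
      (2 * pi * \<i> / fact k * (deriv ^^ k) U 0)) {0..1}"
    unfolding has_contour_integral_def
  proof (rule has_integral_eq[rotated])
    fix t :: real assume "t \<in> {0..1}"
    then show "U (circlepath 0 1 t) / (circlepath 0 1 t - 0) ^ Suc k *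
        vector_derivative (circlepath 0 1) (at t within {0..1}) =
        U (unit_point t) / unit_point t ^ Suc k * (2 * pi * \<i> * unit_point t)"
      using vector_derivative_circlepath01[of t 0 1] by (simp add: circlepath unit_point_def)
  qed
  then have "((\<lambda>t. U (unit_point t) / unit_point t ^ Suc k * (2 * pi * \<i> * unit_point t) / (2 * pi * \<i>)) has_integral
      (2 * pi * \<i> / fact k * (deriv ^^ k) U 0) / (2 * pi * \<i>)) {0..1}"
    by (rule has_integral_divide)
  moreover have "U (unit_point t) / unit_point t ^ Suc k * (2 * pi * \<i> * unit_point t) / (2 * pi * \<i>)
      = U (unit_point t) / unit_point t ^ k" for t
    by (simp add: unit_point_def)
  ultimately have "((\<lambda>t. U (unit_point t) / unit_point t ^ k) has_integral
      (2 * pi * \<i> / fact k * (deriv ^^ k) U 0) / (2 * pi * \<i>)) {0..1}"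
    by simp
  then show ?thesis unfolding mean_def by (simp add: integral_unique)
qed

lemma mean_power_holomorphic:
  assumes U: "U holomorphic_on ball 0 \<rho>" and \<rho>: "\<rho> > 1" and k: "k > 0"
  shows "mean (\<lambda>z. z ^ k * U z) = 0"
proof -
  have "(\<lambda>z. z ^ k * U z) holomorphic_on ball 0 \<rho>" using U by (intro holomorphic_intros)
  from mean_inverse_power_holomorphic[OF this \<rho>, of 0] show ?thesis using k by simp
qed

lemma mean_power_int: "mean (\<lambda>z. z powi e) = (if e = 0 then 1 else 0)"
proof (cases "e \<ge> 0")
  case True
  then obtain k where "e = int k" by (metis nonneg_int_cases)
  then show ?thesis
    using mean_power_holomorphic[of "\<lambda>_. 1" 2 k] by (cases "k = 0") (auto simp: mean_def)
next
  case False
  then have k: "e = - int (nat (- e))" "nat (- e) > 0" by auto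
  define k where "k = nat (- e)"
  have k: "e = - int k" "k > 0" using k by (simp_all add: k_def)
  have "mean (\<lambda>z. 1 / z ^ k) = 0"
    using mean_inverse_power_holomorphic[of "\<lambda>_. 1" 2 k] k(2) by (simp add: higher_deriv_const)
  moreover have "z powi e = 1 / z ^ k" for z :: complex
    using k by (simp add: power_int_minus divide_inverse)
  ultimately show ?thesis using k by simp
qed

text \<open>
  A power series all of whose coefficients from index \<open>d\<close> on vanish is a polynomial.
\<close>

lemma holomorphic_eq_polynomial:
  assumes U: "U holomorphic_on ball 0 \<rho>" and \<rho>: "\<rho> > 1"
    and van: "\<And>k. k \<ge> d \<Longrightarrow> mean (\<lambda>z. U z / z ^ k) = 0"
    and z: "z \<in> ball 0 \<rho>"
  shows "U z = (\<Sum>k<d. mean (\<lambda>z. U z / z ^ k) * z ^ k)"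
proof -
  have "(\<lambda>k. (deriv ^^ k) U 0 / fact k * (z - 0) ^ k) sums U z"
    by (rule holomorphic_power_series[OF U z])
  then have "(\<lambda>k. mean (\<lambda>z. U z / z ^ k) * z ^ k) sums U z"
    by (simp add: mean_inverse_power_holomorphic[OF U \<rho>])
  moreover have "(\<lambda>k. mean (\<lambda>z. U z / z ^ k) * z ^ k) sums (\<Sum>k<d. mean (\<lambda>z. U z / z ^ k) * z ^ k)"
    by (rule sums_finite) (auto simp: van)
  ultimately show ?thesis by (rule sums_unique2)
qed


section \<open>Splitting rational functions into parts holomorphic inside and outside the disc\<close>

text \<open>
  A Laurent decomposition near the circle: \<open>u\<close> carries the nonnegative Fourier modes and \<open>v\<close> the nonpositive
  ones; the radius exceeds \<open>1\<close> so that Cauchy's formula applies on the circle itself.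
\<close>

definition splits :: "(complex \<Rightarrow> complex) \<Rightarrow> bool" where
  "splits f \<longleftrightarrow> (\<exists>\<rho>>1. \<exists>u v. u holomorphic_on ball 0 \<rho> \<and> v holomorphic_on ball 0 \<rho> \<and>
     (\<forall>z\<in>circle. f z = u z + v (inverse z)))"

lemma splits_cong: "splits f \<Longrightarrow> (\<And>z. z \<in> circle \<Longrightarrow> f z = g z) \<Longrightarrow> splits g"
  unfolding splits_def by (metis (no_types, lifting))

lemma splits_holomorphic: "u holomorphic_on UNIV \<Longrightarrow> splits u"
  unfolding splits_def
  by (rule exI[of _ 2], simp, rule exI[of _ u], intro conjI)
    (auto intro: holomorphic_on_subset exI[of _ "\<lambda>_. 0"])

lemma splits_cmult:
  assumes "splits f" shows "splits (\<lambda>z. c * f z)"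
proof -
  obtain \<rho> u v where h: "\<rho> > 1" "u holomorphic_on ball 0 \<rho>" "v holomorphic_on ball 0 \<rho>"
    "\<And>z. z \<in> circle \<Longrightarrow> f z = u z + v (inverse z)" using assms unfolding splits_def by blast
  show ?thesis unfolding splits_def
    by (rule exI[of _ \<rho>], intro conjI h exI[of _ "\<lambda>z. c * u z"] exI[of _ "\<lambda>z. c * v z"])
      (auto intro!: holomorphic_intros h simp: h(4) algebra_simps)
qed

lemma splits_inverse_arg:
  assumes "splits f" shows "splits (\<lambda>z. f (inverse z))"
proof -
  obtain \<rho> u v where h: "\<rho> > 1" "u holomorphic_on ball 0 \<rho>" "v holomorphic_on ball 0 \<rho>"
    "\<And>z. z \<in> circle \<Longrightarrow> f z = u z + v (inverse z)" using assms unfolding splits_def by blast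
  show ?thesis unfolding splits_def
    by (rule exI[of _ \<rho>], intro conjI h exI[of _ v] exI[of _ u]) (auto simp: h(4) norm_inverse)
qed

text \<open>
  Partial fractions for one pole inside the disc. The quotient \<open>(u(z) - u(r)) / (z - r)\<close> has a removable
  singularity, and the remaining numerator is divided in the variable \<open>w = 1/z\<close>, where
  \<open>1 / (z - r) = w / (1 - r w)\<close> is holomorphic for \<open>|w| < 1 / |r|\<close>.
\<close>

lemma splits_divide_inner:
  assumes "splits f" and r: "norm r < 1"
  shows "splits (\<lambda>z. f z / (z - r))"
proof -
  obtain \<rho> u v where h: "\<rho> > 1" "u holomorphic_on ball 0 \<rho>" "v holomorphic_on ball 0 \<rho>"
    "\<And>z. z \<in> circle \<Longrightarrow> f z = u z + v (inverse z)" using assms(1) unfolding splits_def by blast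
  define \<sigma> where "\<sigma> = (if r = 0 then \<rho> else min \<rho> (1 / norm r))"
  have \<sigma>: "\<sigma> > 1" "\<sigma> \<le> \<rho>" using h(1) r by (auto simp: \<sigma>_def)
  have nz: "1 - r * w \<noteq> 0" if "w \<in> ball 0 \<sigma>" for w
  proof
    assume e: "1 - r * w = 0"
    then have "r \<noteq> 0" by auto
    moreover have "norm r * norm w = 1" using e by (simp flip: norm_mult)
    ultimately show False using that by (auto simp: \<sigma>_def field_simps)
  qed
  define u' where "u' z = (if z = r then deriv u r else (u z - u r) / (z - r))" for z
  define v' where "v' w = (u r + v w) * w / (1 - r * w)" for w
  have sub: "ball 0 \<sigma> \<subseteq> ball (0::complex) \<rho>" using \<sigma> by auto
  have "u' holomorphic_on ball 0 \<rho>"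
    unfolding u'_def using h(1,2) r by (intro pole_lemma) auto
  then have "u' holomorphic_on ball 0 \<sigma>" using sub holomorphic_on_subset by blast
  moreover have "v' holomorphic_on ball 0 \<sigma>"
    unfolding v'_def using nz by (intro holomorphic_intros holomorphic_on_subset[OF h(3) sub]) auto
  moreover have "f z / (z - r) = u' z + v' (inverse z)" if z: "z \<in> circle" for z
  proof -
    have "z \<noteq> r" "z \<noteq> 0" using z r by auto
    have "v' (inverse z) = (u r + v (inverse z)) / (z - r)"
      unfolding v'_def using \<open>z \<noteq> r\<close> \<open>z \<noteq> 0\<close> by (simp add: field_simps)
    moreover have "u' z = (u z - u r) / (z - r)" using \<open>z \<noteq> r\<close> by (simp add: u'_def)
    ultimately show ?thesis using h(4)[OF z] by (simp add: add_divide_distrib diff_divide_distrib)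
  qed
  ultimately show ?thesis unfolding splits_def using \<sigma>(1) by blast
qed

lemma splits_mult_variable:
  assumes "splits f" shows "splits (\<lambda>z. z * f z)"
  using splits_inverse_arg[OF splits_divide_inner[OF splits_inverse_arg[OF assms], of 0]]
  by (rule splits_cong) (auto simp: norm_inverse field_simps)

text \<open>
  The substitution \<open>z \<mapsto> 1/z\<close> turns a pole outside the disc into one inside.
\<close>

lemma splits_divide_linear:
  assumes f: "splits f" and r: "norm r \<noteq> 1"
  shows "splits (\<lambda>z. f z / (z - r))"
proof (cases "norm r < 1")
  case True
  then show ?thesis using splits_divide_inner f by blast
next
  case False
  then have r: "norm r > 1" "r \<noteq> 0" using r by auto
  then have "norm (inverse r) < 1" by (simp add: norm_inverse inverse_less_1_iff)
  from splits_inverse_arg[OF splits_mult_variable[OF splits_divide_inner[OF splits_inverse_arg[OF f] this]]]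
  have "splits (\<lambda>z. (- inverse r) * (inverse z * (f (inverse (inverse z)) / (inverse z - inverse r))))"
    by (rule splits_cmult)
  then show ?thesis
  proof (rule splits_cong)
    fix z assume "z \<in> circle"
    then have "z \<noteq> 0" "z \<noteq> r" using r by auto
    then show "(- inverse r) * (inverse z * (f (inverse (inverse z)) / (inverse z - inverse r))) = f z / (z - r)"
      using r by (simp add: field_simps)
  qed
qed

text \<open>
  The zeros of \<open>q\<close> are divided out one after the other.
\<close>

lemma splits_divide_poly:
  assumes "splits f" "\<And>z. z \<in> circle \<Longrightarrow> poly q z \<noteq> 0"
  shows "splits (\<lambda>z. f z / poly q z)"
  using assms
proof (induction "degree q" arbitrary: q f)
  case 0
  then obtain c where "q = [:c:]" by (metis degree_eq_zeroE)
  then show ?case using splits_cmult[OF 0(2), of "inverse c"] by (simp add: divide_inverse mult.commute)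
next
  case (Suc n)
  then have "\<not> constant (poly q)" by (simp add: constant_degree)
  then obtain r where r: "poly q r = 0" using Fundamental_Theorem_Algebra.fundamental_theorem_of_algebra by blast
  then obtain q' where q': "q = [:- r, 1:] * q'" by (metis dvdE poly_eq_0_iff_dvd)
  then have "q' \<noteq> 0" using Suc(2) by auto
  then have "degree q = Suc (degree q')" unfolding q' by (subst degree_mult_eq) auto
  then have "n = degree q'" using Suc(2) by simp
  moreover have "norm r \<noteq> 1" using Suc.prems(2)[of r] r by auto
  then have "splits (\<lambda>z. f z / (z - r))" using splits_divide_linear Suc.prems(1) by blast
  moreover have "poly q' z \<noteq> 0" if "z \<in> circle" for z
    using Suc.prems(2)[OF that] by (auto simp: q')
  ultimately have "splits (\<lambda>z. f z / (z - r) / poly q' z)" by (intro Suc.hyps(1))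
  then show ?case by (simp add: q' algebra_simps)
qed

definition laurent_polynomial :: "(complex \<Rightarrow> complex) \<Rightarrow> bool" where
  "laurent_polynomial f \<longleftrightarrow> (\<exists>p k. \<forall>z\<in>circle. f z = poly p z / z ^ k)"

lemma laurent_polynomial_const: "laurent_polynomial (\<lambda>z. c)"
  unfolding laurent_polynomial_def by (intro exI[of _ "[:c:]"] exI[of _ 0]) auto

lemma laurent_polynomial_power_int: "laurent_polynomial (\<lambda>z. z powi e)"
proof (cases "e \<ge> 0")
  case True
  then show ?thesis unfolding laurent_polynomial_def
    by (intro exI[of _ "monom 1 (nat e)"] exI[of _ 0]) (auto simp: poly_monom power_int_def)
next
  case False
  then show ?thesis unfolding laurent_polynomial_def
    by (intro exI[of _ 1] exI[of _ "nat (- e)"]) (simp add: power_int_def divide_inverse power_inverse)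
qed

lemma laurent_polynomial_add:
  assumes "laurent_polynomial f" "laurent_polynomial g"
  shows "laurent_polynomial (\<lambda>z. f z + g z)"
proof -
  obtain p k where f: "\<And>z. z \<in> circle \<Longrightarrow> f z = poly p z / z ^ k"
    using assms(1) unfolding laurent_polynomial_def by blast
  obtain q l where g: "\<And>z. z \<in> circle \<Longrightarrow> g z = poly q z / z ^ l"
    using assms(2) unfolding laurent_polynomial_def by blast
  show ?thesis unfolding laurent_polynomial_def
  proof (intro exI[of _ "p * monom 1 l + q * monom 1 k"] exI[of _ "k + l"] ballI)
    fix z assume z: "z \<in> circle"
    then have "z \<noteq> 0" by auto
    then show "f z + g z = poly (p * monom 1 l + q * monom 1 k) z / z ^ (k + l)"
      using f[OF z] g[OF z] by (simp add: poly_monom power_add add_frac_eq)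
  qed
qed

lemma laurent_polynomial_mult:
  assumes "laurent_polynomial f" "laurent_polynomial g"
  shows "laurent_polynomial (\<lambda>z. f z * g z)"
proof -
  obtain p k where f: "\<And>z. z \<in> circle \<Longrightarrow> f z = poly p z / z ^ k"
    using assms(1) unfolding laurent_polynomial_def by blast
  obtain q l where g: "\<And>z. z \<in> circle \<Longrightarrow> g z = poly q z / z ^ l"
    using assms(2) unfolding laurent_polynomial_def by blast
  show ?thesis unfolding laurent_polynomial_def
    by (intro exI[of _ "p * q"] exI[of _ "k + l"] ballI) (simp add: f g power_add)
qed

lemma laurent_polynomial_sum:
  "(\<And>i. i \<in> I \<Longrightarrow> laurent_polynomial (f i)) \<Longrightarrow> laurent_polynomial (\<lambda>z. \<Sum>i\<in>I. f i z)"
  by (induction I rule: infinite_finite_induct)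
    (auto intro: laurent_polynomial_const laurent_polynomial_add)

lemma laurent_polynomial_prod:
  "(\<And>i. i \<in> I \<Longrightarrow> laurent_polynomial (f i)) \<Longrightarrow> laurent_polynomial (\<lambda>z. \<Prod>i\<in>I. f i z)"
  by (induction I rule: infinite_finite_induct)
    (auto intro: laurent_polynomial_const laurent_polynomial_mult)

lemma laurent_polynomial_det:
  fixes A :: "complex \<Rightarrow> complex^'m^'m"
  assumes "\<And>i j. laurent_polynomial (\<lambda>z. A z $ i $ j)"
  shows "laurent_polynomial (\<lambda>z. det (A z))"
  unfolding det_def
  by (intro laurent_polynomial_sum laurent_polynomial_mult laurent_polynomial_const laurent_polynomial_prod assms)

lemma splits_divide_laurent_polynomial:
  assumes f: "laurent_polynomial f" and g: "laurent_polynomial g" "\<And>z. z \<in> circle \<Longrightarrow> g z \<noteq> 0"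
  shows "splits (\<lambda>z. f z / g z)"
proof -
  obtain p k where p: "\<And>z. z \<in> circle \<Longrightarrow> f z = poly p z / z ^ k"
    using f unfolding laurent_polynomial_def by blast
  obtain q l where q: "\<And>z. z \<in> circle \<Longrightarrow> g z = poly q z / z ^ l"
    using g(1) unfolding laurent_polynomial_def by blast
  have "splits (\<lambda>z. poly (p * monom 1 l) z / poly (q * monom 1 k) z)"
  proof (rule splits_divide_poly)
    show "splits (poly (p * monom 1 l))"
      by (intro splits_holomorphic holomorphic_intros)
    show "poly (q * monom 1 k) z \<noteq> 0" if "z \<in> circle" for z
      using q[OF that] g(2)[OF that] that by (auto simp: poly_monom)
  qed
  then show ?thesis
    by (rule splits_cong) (simp add: p q poly_monom mult.commute)
qed

text \<open>
  By Cramer's rule, solutions of linear systems with Laurent polynomial entries are rational functions without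
  poles on the circle.
\<close>

lemma splits_cramer:
  fixes A :: "complex \<Rightarrow> complex^'m^'m"
  assumes A: "\<And>i j. laurent_polynomial (\<lambda>z. A z $ i $ j)" and b: "\<And>i. laurent_polynomial (\<lambda>z. b z $ i)"
    and inv: "\<And>z. z \<in> circle \<Longrightarrow> det (A z) \<noteq> 0"
    and F: "\<And>z. z \<in> circle \<Longrightarrow> A z *v F z = b z"
  shows "splits (\<lambda>z. F z $ k)"
proof -
  have "splits (\<lambda>z. det (\<chi> i j. if j = k then b z $ i else A z $ i $ j) / det (A z))"
  proof (intro splits_divide_laurent_polynomial laurent_polynomial_det inv)
    fix i j
    show "laurent_polynomial (\<lambda>z. (\<chi> i j. if j = k then b z $ i else A z $ i $ j) $ i $ j)"
      using A b by (cases "j = k") auto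
  qed (use A in auto)
  then show ?thesis
  proof (rule splits_cong)
    fix z assume z: "z \<in> circle"
    show "det (\<chi> i j. if j = k then b z $ i else A z $ i $ j) / det (A z) = F z $ k"
      using F[OF z] cramer[OF inv[OF z], of "F z" "b z"] by (metis (no_types, lifting) vec_lambda_beta)
  qed
qed


section \<open>Nondegenerate symbols and perturbation by scalars\<close>

lemma matrix_inv_det_nonzero:
  fixes A :: "complex^'m^'m"
  assumes "det A \<noteq> 0"
  shows "A ** matrix_inv A = mat 1" "matrix_inv A ** A = mat 1"
proof -
  have "\<exists>B. A ** B = mat 1 \<and> B ** A = mat 1"
    using assms by (simp add: invertible_det_nz[symmetric] invertible_def)
  from someI_ex[OF this] show "A ** matrix_inv A = mat 1" "matrix_inv A ** A = mat 1"
    by (simp_all add: matrix_inv_def)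
qed

lemma det_nonzero_cancel:
  fixes A :: "complex^'m^'m"
  assumes "det A \<noteq> 0" "A *v x = A *v y" shows "x = y"
proof -
  have "matrix_inv A ** A = mat 1" using assms(1) by (rule matrix_inv_det_nonzero)
  then show ?thesis using assms(2) by (metis matrix_vector_mul_assoc matrix_vector_mul_lid)
qed

lemma det_nonzero_kernel:
  fixes A :: "complex^'m^'m"
  assumes "det A \<noteq> 0" "A *v x = 0" shows "x = 0"
  using det_nonzero_cancel[OF assms(1), of x 0] assms(2) by simp

text \<open>
  Compactness of the circle times the unit sphere gives a uniform gap around \<open>0\<close> in the spectra of all \<open>a z\<close>.
\<close>

lemma matrix_family_bounded_below:
  fixes a :: "complex \<Rightarrow> complex^'m^'m"
  assumes a: "continuous_on circle a" and det: "\<And>z. z \<in> circle \<Longrightarrow> det (a z) \<noteq> 0"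
  shows "\<exists>\<delta>>0. \<forall>z\<in>circle. \<forall>x. \<delta> * norm x \<le> norm (a z *v x)"
proof -
  let ?K = "circle \<times> sphere (0::complex^'m) 1"
  let ?f = "\<lambda>p. norm (a (fst p) *v snd p)"
  have ca: "continuous_on ?K (\<lambda>p. a (fst p))"
    by (rule continuous_on_compose2[OF a]) (auto intro: continuous_intros)
  then have cont: "continuous_on ?K ?f"
    unfolding matrix_vector_mult_def by (intro continuous_intros)
  have "(1, axis undefined 1) \<in> ?K" by simp
  then have ne: "?K \<noteq> {}" by blast
  obtain p where p: "p \<in> ?K" "\<And>q. q \<in> ?K \<Longrightarrow> ?f p \<le> ?f q"
    using continuous_attains_inf[OF _ ne cont] by (auto simp: compact_Times)
  have "?f p > 0"
    using p(1) det_nonzero_kernel[OF det[of "fst p"], of "snd p"] by force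
  moreover have "?f p * norm x \<le> norm (a z *v x)" if z: "z \<in> circle" for z x
  proof (cases "x = 0")
    case False
    let ?c = "complex_of_real (inverse (norm x))"
    from False have "?f p \<le> norm (a z *v (?c *s x))"
      using p(2)[of "(z, ?c *s x)"] z by (simp add: norm_vector_scalar_mult norm_inverse)
    also have "\<dots> = inverse (norm x) * norm (a z *v x)"
      by (simp only: vec.scale norm_vector_scalar_mult norm_of_real) simp
    finally show ?thesis using False by (simp add: field_simps)
  qed simp
  ultimately show ?thesis by blast
qed

definition negative_part :: "nat \<Rightarrow> (nat \<Rightarrow> complex^'m) \<Rightarrow> complex \<Rightarrow> complex^'m" where
  "negative_part d g z = (\<Sum>k\<in>{1..d}. inverse z ^ k *s g k)"

lemma negative_part_nth: "negative_part d g z $ i = (\<Sum>k\<in>{1..d}. inverse z ^ k * g k $ i)"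
  by (simp add: negative_part_def)

lemma mean_mult_negative_part:
  assumes "k \<in> {1..d}"
  shows "mean (\<lambda>z. z ^ k * negative_part d g z $ i) = g k $ i"
proof -
  have "mean (\<lambda>z. z ^ k * negative_part d g z $ i) = mean (\<lambda>z. \<Sum>l\<in>{1..d}. g l $ i * z powi (int k - int l))"
  proof (rule mean_cong)
    fix z :: complex assume "z \<in> circle"
    then have "z \<noteq> 0" by auto
    then show "z ^ k * negative_part d g z $ i = (\<Sum>l\<in>{1..d}. g l $ i * z powi (int k - int l))"
      by (simp add: negative_part_nth sum_distrib_left power_int_diff field_simps)
  qed
  also have "\<dots> = (\<Sum>l\<in>{1..d}. g l $ i * (if int k - int l = 0 then 1 else 0))"
    by (subst mean_sum) (auto intro!: continuous_intros simp: mean_cmult mean_power_int)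
  also have "\<dots> = g k $ i"
    using assms by (simp add: if_distrib[of "\<lambda>x. _ * x"] cong: if_cong)
  finally show ?thesis .
qed

lemma negative_part_eq_0:
  assumes "\<And>z. z \<in> circle \<Longrightarrow> negative_part d g z = 0" "k \<in> {1..d}"
  shows "g k = 0"
proof -
  have "g k $ i = 0" for i
  proof -
    have "mean (\<lambda>z. z ^ k * negative_part d g z $ i) = mean (\<lambda>z. 0)"
      by (rule mean_cong) (simp add: assms(1))
    then show ?thesis using mean_mult_negative_part[OF assms(2), of g i] by simp
  qed
  then show ?thesis by (simp add: vec_eq_iff)
qed

text \<open>
  The mean of \<open>z\<^sup>k f\<close> is the Fourier coefficient of \<open>f\<close> with index \<open>-k\<close>.
\<close>

definition no_negative_modes :: "nat \<Rightarrow> (complex \<Rightarrow> complex^'m) \<Rightarrow> bool" where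
  "no_negative_modes d f \<longleftrightarrow> (\<forall>k\<in>{1..d}. \<forall>i. mean (\<lambda>z. z ^ k * f z $ i) = 0)"

text \<open>
  The compression of multiplication by \<open>a\<^sup>-\<^sup>1\<close> to the span of the modes \<open>-d, \<dots>, -1\<close> is injective; here
  \<open>f = a\<^sup>-\<^sup>1 g\<close>. Because \<open>a\<close> has degree at most \<open>d\<close> in the application, this is a finite-dimensional substitute
  for invertibility of the Toeplitz operators with symbol \<open>a\<close> on the nonnegative modes and on the modes below \<open>-d\<close>.
\<close>

definition toeplitz_nondegenerate :: "nat \<Rightarrow> (complex \<Rightarrow> complex^'m^'m) \<Rightarrow> bool" where
  "toeplitz_nondegenerate d a \<longleftrightarrow> (\<forall>g f. continuous_on circle f \<longrightarrow>
     (\<forall>z\<in>circle. a z *v f z = negative_part d g z) \<longrightarrow> no_negative_modes d f \<longrightarrow>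
     (\<forall>k\<in>{1..d}. g k = 0))"

lemma cnj_inverse_circle: "z \<in> circle \<Longrightarrow> cnj (inverse z) = z"
proof -
  assume "z \<in> circle"
  then have "cnj z * z = 1" using complex_norm_square[of z] by (simp add: mult.commute)
  then have "inverse (cnj z) = z" by (rule inverse_unique)
  then show ?thesis by simp
qed

lemma continuous_on_cinner:
  "continuous_on S f \<Longrightarrow> continuous_on S g \<Longrightarrow> continuous_on S (\<lambda>z. cinner (f z) (g z))"
  unfolding cinner_def by (intro continuous_intros)

text \<open>
  A combination of the modes \<open>-1, \<dots>, -d\<close> is orthogonal in \<open>L\<^sup>2\<close> of the circle to a function that lacks them.
\<close>

lemma mean_cinner_negative_part:
  assumes f: "continuous_on circle f" and van: "no_negative_modes d f"
  shows "mean (\<lambda>z. cinner (negative_part d g z) (f z)) = 0"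
proof -
  have "mean (\<lambda>z. cinner (negative_part d g z) (f z))
      = mean (\<lambda>z. \<Sum>k\<in>{1..d}. \<Sum>i\<in>UNIV. cnj (g k $ i) * (z ^ k * f z $ i))"
  proof (rule mean_cong)
    fix z :: complex assume z: "z \<in> circle"
    show "cinner (negative_part d g z) (f z) = (\<Sum>k\<in>{1..d}. \<Sum>i\<in>UNIV. cnj (g k $ i) * (z ^ k * f z $ i))"
      unfolding negative_part_def cinner_sum_left
      by (intro sum.cong refl)
        (simp add: cinner_def sum_distrib_left cnj_inverse_circle[OF z, simplified] mult_ac)
  qed
  also have "\<dots> = (\<Sum>k\<in>{1..d}. \<Sum>i\<in>UNIV. cnj (g k $ i) * mean (\<lambda>z. z ^ k * f z $ i))"
    by (subst mean_sum, intro continuous_intros f, intro sum.cong refl)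
      (subst mean_sum, auto intro!: continuous_intros f simp: mean_cmult)
  also have "\<dots> = 0" using van by (simp add: no_negative_modes_def)
  finally show ?thesis .
qed

definition mean_square :: "(complex \<Rightarrow> complex^'m) \<Rightarrow> real" where
  "mean_square f = integral {0..1} (\<lambda>t. (norm (f (unit_point t)))\<^sup>2)"

lemma continuous_on_norm_square:
  assumes "continuous_on circle (f :: complex \<Rightarrow> complex^'m)"
  shows "continuous_on {0..1::real} (\<lambda>t. (norm (f (unit_point t)))\<^sup>2)"
  by (intro continuous_intros continuous_on_comp_unit_point assms)

lemma mean_cinner_self:
  assumes "continuous_on circle f"
  shows "mean (\<lambda>z. cinner (f z) (f z)) = complex_of_real (mean_square f)"
proof -
  have "integral {0..1} (\<lambda>t. complex_of_real ((norm (f (unit_point t)))\<^sup>2)) = complex_of_real (mean_square f)"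
    unfolding mean_square_def
    using integral_linear[OF integrable_continuous_interval[OF continuous_on_norm_square[OF assms]] bounded_linear_of_real]
    by (simp add: o_def)
  then show ?thesis by (simp add: mean_def cinner_self)
qed

lemma mean_square_nonneg: "0 \<le> mean_square f"
  unfolding mean_square_def
  by (cases "(\<lambda>t. (norm (f (unit_point t)))\<^sup>2) integrable_on {0..1}")
    (auto intro: Henstock_Kurzweil_Integration.integral_nonneg simp: not_integrable_integral)

lemma mean_square_eq_0:
  assumes f: "continuous_on circle f" and "mean_square f = 0" "z \<in> circle"
  shows "f z = 0"
proof -
  obtain t where t: "t \<in> {0..1}" "unit_point t = z" using unit_point_surj[OF assms(3)] by blast
  have "(norm (f (unit_point t)))\<^sup>2 = 0"
    using integral_eq_0_iff[OF continuous_on_norm_square[OF f]] assms(2) t(1)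
    unfolding mean_square_def by auto
  then show ?thesis using t by simp
qed

text \<open>
  The theorem of Pythagoras in \<open>L\<^sup>2\<close> of the circle.
\<close>

lemma mean_square_orthogonal_sum:
  assumes f: "\<And>e. e \<in> E \<Longrightarrow> continuous_on circle (f e)" and E: "finite E"
    and orth: "\<And>e e'. e \<in> E \<Longrightarrow> e' \<in> E \<Longrightarrow> e \<noteq> e' \<Longrightarrow> mean (\<lambda>z. cinner (f e z) (f e' z)) = 0"
  shows "mean_square (\<lambda>z. \<Sum>e\<in>E. c e *s f e z) = (\<Sum>e\<in>E. (norm (c e))\<^sup>2 * mean_square (f e))"
proof -
  have scal: "continuous_on circle (\<lambda>z. c e *s f e z)" if "e \<in> E" for e
    unfolding vector_scalar_mult_def by (intro continuous_intros f that)
  have "complex_of_real (mean_square (\<lambda>z. \<Sum>e\<in>E. c e *s f e z))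
      = mean (\<lambda>z. cinner (\<Sum>e\<in>E. c e *s f e z) (\<Sum>e\<in>E. c e *s f e z))"
    by (rule mean_cinner_self[symmetric]) (intro continuous_intros scal)
  also have "\<dots> = (\<Sum>e\<in>E. \<Sum>e'\<in>E. cnj (c e) * c e' * mean (\<lambda>z. cinner (f e z) (f e' z)))"
  proof -
    have "mean (\<lambda>z. cinner (\<Sum>e\<in>E. c e *s f e z) (\<Sum>e\<in>E. c e *s f e z))
       = mean (\<lambda>z. \<Sum>e\<in>E. \<Sum>e'\<in>E. cnj (c e) * c e' * cinner (f e z) (f e' z))"
      unfolding cinner_sum_left unfolding cinner_sum_right by (simp add: mult_ac)
    also have "\<dots> = (\<Sum>e\<in>E. mean (\<lambda>z. \<Sum>e'\<in>E. cnj (c e) * c e' * cinner (f e z) (f e' z)))"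
      by (intro mean_sum continuous_intros continuous_on_cinner f)
    also have "\<dots> = (\<Sum>e\<in>E. \<Sum>e'\<in>E. mean (\<lambda>z. cnj (c e) * c e' * cinner (f e z) (f e' z)))"
      by (intro sum.cong refl mean_sum continuous_intros continuous_on_cinner f)
    finally show ?thesis by (simp add: mean_cmult)
  qed
  also have "\<dots> = (\<Sum>e\<in>E. \<Sum>e'\<in>E. if e = e' then complex_of_real ((norm (c e))\<^sup>2 * mean_square (f e)) else 0)"
    by (intro sum.cong refl)
      (simp add: orth mean_cinner_self f complex_norm_square mult_ac del: of_real_power)
  also have "\<dots> = (\<Sum>e\<in>E. complex_of_real ((norm (c e))\<^sup>2 * mean_square (f e)))"
    using E by (intro sum.cong refl) (simp add: sum.delta)
  finally show ?thesis by (simp flip: of_real_sum of_real_mult of_real_power)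
qed

lemma continuous_on_negative_part: "continuous_on circle (negative_part d g)"
  unfolding negative_part_def vector_scalar_mult_def by (intro continuous_intros) auto

text \<open>
  The argument that makes eigenvectors of a self-adjoint operator for distinct eigenvalues orthogonal: both
  \<open>(a + e) f\<close> and \<open>(a + e') f'\<close> are combinations of the modes \<open>-1, \<dots>, -d\<close>, hence orthogonal to \<open>f'\<close> and \<open>f\<close>
  respectively, and the difference of the two relations is \<open>(e - e')\<close> times the inner product of \<open>f\<close> and \<open>f'\<close>.
\<close>

lemma orthogonal_modes:
  assumes herm: "\<And>z. z \<in> circle \<Longrightarrow> hermitian_mat (a z)"
    and f: "continuous_on circle f" "continuous_on circle f'"
    and eq: "\<And>z. z \<in> circle \<Longrightarrow> (a z + mat (complex_of_real e)) *v f z = negative_part d g z"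
      "\<And>z. z \<in> circle \<Longrightarrow> (a z + mat (complex_of_real e')) *v f' z = negative_part d g' z"
    and van: "no_negative_modes d f" "no_negative_modes d f'" and ne: "e \<noteq> e'"
  shows "mean (\<lambda>z. cinner (f z) (f' z)) = 0"
proof -
  have 1: "mean (\<lambda>z. cinner (negative_part d g z) (f' z)) = 0"
    by (rule mean_cinner_negative_part[OF f(2) van(2)])
  have "mean (\<lambda>z. cnj (cinner (negative_part d g' z) (f z))) = 0"
    unfolding mean_cnj using mean_cinner_negative_part[OF f(1) van(1)] by simp
  then have 2: "mean (\<lambda>z. cinner (f z) (negative_part d g' z)) = 0" by simp
  have "mean (\<lambda>z. complex_of_real (e - e') * cinner (f z) (f' z))
      = mean (\<lambda>z. cinner (negative_part d g z) (f' z) - cinner (f z) (negative_part d g' z))"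
  proof (rule mean_cong)
    fix z assume z: "z \<in> circle"
    show "complex_of_real (e - e') * cinner (f z) (f' z) =
      cinner (negative_part d g z) (f' z) - cinner (f z) (negative_part d g' z)"
      unfolding eq(1)[OF z, symmetric] eq(2)[OF z, symmetric]
      by (simp add: matrix_vector_mult_add_rdistrib mat_mult_vec hermitian_cinner[OF herm[OF z]] algebra_simps)
  qed
  also have "\<dots> = 0"
    using 1 2 by (subst mean_diff) (auto intro!: continuous_on_cinner f continuous_on_negative_part)
  finally show ?thesis using ne by (simp add: mean_cmult)
qed

text \<open>
  Fewer than \<open>m d + 1\<close> values in \<open>(0, \<delta>)\<close> are exceptional. For otherwise \<open>m d + 1\<close> of the right-hand sides
  \<open>(a + e) f\<^sub>e\<close> are linearly dependent, as they lie in a space of dimension \<open>m d\<close>. With the coefficients \<open>c\<^sub>e\<close> of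
  such a relation, \<open>h = \<Sum> c\<^sub>e f\<^sub>e\<close> satisfies \<open>a h = - \<Sum> e c\<^sub>e f\<^sub>e\<close>. The \<open>f\<^sub>e\<close> are orthogonal and every \<open>e\<close>
  is less than \<open>\<delta>\<close>, so \<open>a h\<close> has smaller \<open>L\<^sup>2\<close> norm than \<open>\<delta> h\<close>, contradicting the bound from below.
\<close>

lemma nondegenerate_perturbation:
  fixes a :: "complex \<Rightarrow> complex^'m^'m"
  assumes a: "continuous_on circle a" and herm: "\<And>z. z \<in> circle \<Longrightarrow> hermitian_mat (a z)"
    and bound: "\<And>z x. z \<in> circle \<Longrightarrow> \<delta> * norm x \<le> norm (a z *v x)" and \<delta>: "\<delta> > 0"
  shows "\<exists>e. 0 < e \<and> e < \<delta> \<and> toeplitz_nondegenerate d (\<lambda>z. a z + mat (complex_of_real e))"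
proof (rule ccontr)
  assume not_nondegenerate: "\<not> ?thesis"
  define bad where "bad e g f \<longleftrightarrow> continuous_on circle f \<and>
     (\<forall>z\<in>circle. (a z + mat (complex_of_real e)) *v f z = negative_part d g z) \<and>
     no_negative_modes d f \<and> (\<exists>k\<in>{1..d}. g k \<noteq> 0)" for e g f
  have "\<exists>g f. bad e g f" if "e \<in> {0<..<\<delta>}" for e
  proof -
    have "\<not> toeplitz_nondegenerate d (\<lambda>z. a z + mat (complex_of_real e))"
      using not_nondegenerate that by auto
    then show ?thesis unfolding toeplitz_nondegenerate_def bad_def by blast
  qed
  then obtain g f where bad: "\<And>e. e \<in> {0<..<\<delta>} \<Longrightarrow> bad e (g e) (f e)" by metis
  have f: "continuous_on circle (f e)" and van: "no_negative_modes d (f e)"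
    and nz: "\<exists>k\<in>{1..d}. g e k \<noteq> 0" if "e \<in> {0<..<\<delta>}" for e
    using bad[OF that] by (simp_all add: bad_def)
  have eq: "(a z + mat (complex_of_real e)) *v f e z = negative_part d (g e) z"
    if "e \<in> {0<..<\<delta>}" "z \<in> circle" for e z
    using bad[OF that(1)] that(2) by (simp add: bad_def)
  have "infinite {0<..<\<delta>}" using \<delta> by (simp add: infinite_Ioo)
  then obtain E where E: "E \<subseteq> {0<..<\<delta>}" "finite E" "card E = Suc (d * CARD('m))"
    using infinite_arbitrarily_large by metis
  have "card ({1..d} \<times> (UNIV :: 'm set)) < card E" using E by (simp add: card_cartesian_product)
  then obtain c where c: "\<exists>e\<in>E. c e \<noteq> 0" "\<forall>p\<in>{1..d} \<times> UNIV. (\<Sum>e\<in>E. g e (fst p) $ snd p * c e) = 0"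
    using underdetermined_system[of "{1..d} \<times> UNIV" E "\<lambda>p e. g e (fst p) $ snd p"] E(2) by auto
  have dep: "(\<Sum>e\<in>E. c e *s negative_part d (g e) z) = 0" for z
  proof -
    have "(\<Sum>e\<in>E. c e * (\<Sum>k\<in>{1..d}. inverse z ^ k * g e k $ i)) = 0" for i
    proof -
      have "(\<Sum>e\<in>E. c e * (\<Sum>k\<in>{1..d}. inverse z ^ k * g e k $ i))
         = (\<Sum>e\<in>E. \<Sum>k\<in>{1..d}. inverse z ^ k * (g e k $ i * c e))"
        by (simp add: sum_distrib_left mult_ac)
      also have "\<dots> = (\<Sum>k\<in>{1..d}. \<Sum>e\<in>E. inverse z ^ k * (g e k $ i * c e))" by (rule sum.swap)
      also have "\<dots> = (\<Sum>k\<in>{1..d}. inverse z ^ k * (\<Sum>e\<in>E. g e k $ i * c e))"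
        by (simp add: sum_distrib_left)
      also have "\<dots> = 0" using c(2) by (intro sum.neutral) auto
      finally show ?thesis .
    qed
    then show ?thesis by (simp add: vec_eq_iff negative_part_nth)
  qed
  have orth: "mean (\<lambda>z. cinner (f e z) (f e' z)) = 0" if "e \<in> E" "e' \<in> E" "e \<noteq> e'" for e e'
    using that E(1) by (intro orthogonal_modes[OF herm f f eq eq van van]) auto
  define h where "h z = (\<Sum>e\<in>E. c e *s f e z)" for z
  define h' where "h' z = (\<Sum>e\<in>E. (- complex_of_real e * c e) *s f e z)" for z
  have cont: "continuous_on circle h" "continuous_on circle h'"
    unfolding h_def h'_def vector_scalar_mult_def using f E(1) by (auto intro!: continuous_intros)
  have ah: "a z *v h z = h' z" if z: "z \<in> circle" for z
  proof -
    have "a z *v h z = (\<Sum>e\<in>E. c e *s (a z *v f e z))" by (simp add: h_def vec.sum vec.scale)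
    also have "\<dots> = (\<Sum>e\<in>E. c e *s (negative_part d (g e) z - complex_of_real e *s f e z))"
    proof (intro sum.cong refl)
      fix e assume "e \<in> E"
      then have "e \<in> {0<..<\<delta>}" using E(1) by blast
      then have "a z *v f e z + complex_of_real e *s f e z = negative_part d (g e) z"
        using eq[OF _ z, of e] by (simp add: matrix_vector_mult_add_rdistrib mat_mult_vec)
      then have "a z *v f e z = negative_part d (g e) z - complex_of_real e *s f e z"
        by (simp add: eq_diff_eq)
      then show "c e *s (a z *v f e z) = c e *s (negative_part d (g e) z - complex_of_real e *s f e z)"
        by simp
    qed
    also have "\<dots> = (\<Sum>e\<in>E. c e *s negative_part d (g e) z) + h' z"
      by (simp add: h'_def vec_eq_iff sum.distrib[symmetric] algebra_simps)
    finally show ?thesis by (simp add: dep)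
  qed
  have "\<delta>\<^sup>2 * mean_square h \<le> mean_square h'"
    unfolding mean_square_def integral_mult_right[symmetric]
  proof (intro integral_le integrable_continuous_interval continuous_on_mult continuous_on_const continuous_on_norm_square cont)
    fix t :: real
    have "\<delta> * norm (h (unit_point t)) \<le> norm (h' (unit_point t))"
      using bound[of "unit_point t" "h (unit_point t)"] ah[of "unit_point t"] by simp
    then show "\<delta>\<^sup>2 * (norm (h (unit_point t)))\<^sup>2 \<le> (norm (h' (unit_point t)))\<^sup>2"
      using \<delta> by (metis (no_types, lifting) less_imp_le mult_nonneg_nonneg norm_ge_zero power_mono power_mult_distrib)
  qed
  moreover have "mean_square h = (\<Sum>e\<in>E. (norm (c e))\<^sup>2 * mean_square (f e))"
    unfolding h_def using E f orth by (intro mean_square_orthogonal_sum) auto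
  moreover have "mean_square h' = (\<Sum>e\<in>E. (norm (- complex_of_real e * c e))\<^sup>2 * mean_square (f e))"
    unfolding h'_def using E f orth by (intro mean_square_orthogonal_sum) auto
  ultimately have le: "(\<Sum>e\<in>E. (\<delta>\<^sup>2 - e\<^sup>2) * ((norm (c e))\<^sup>2 * mean_square (f e))) \<le> 0"
    by (simp add: sum_distrib_left left_diff_distrib sum_subtractf norm_mult power_mult_distrib mult.assoc)
  have pos: "\<delta>\<^sup>2 - e\<^sup>2 > 0" if "e \<in> E" for e
    using that E(1) by (auto intro!: power_strict_mono)
  have nonneg: "0 \<le> (\<delta>\<^sup>2 - e\<^sup>2) * ((norm (c e))\<^sup>2 * mean_square (f e))" if "e \<in> E" for e
    using pos[OF that] by (intro mult_nonneg_nonneg mean_square_nonneg) auto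
  obtain e where e: "e \<in> E" "c e \<noteq> 0" using c(1) by blast
  let ?s = "\<lambda>e. (\<delta>\<^sup>2 - e\<^sup>2) * ((norm (c e))\<^sup>2 * mean_square (f e))"
  have "0 \<le> (\<Sum>e\<in>E. ?s e)" by (rule sum_nonneg) (rule nonneg)
  with le have "(\<Sum>e\<in>E. ?s e) = 0" by linarith
  then have "\<forall>e\<in>E. ?s e = 0" using sum_nonneg_eq_0_iff[OF E(2), of ?s] nonneg by blast
  then have "?s e = 0" using e(1) by blast
  then have "mean_square (f e) = 0" using pos[OF e(1)] e(2) by simp
  moreover have eE: "e \<in> {0<..<\<delta>}" using e E by blast
  ultimately have "f e z = 0" if "z \<in> circle" for z
    using mean_square_eq_0[OF f _ that] by blast
  then have "negative_part d (g e) z = 0" if "z \<in> circle" for z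
    using eq[OF eE that] that by simp
  then show False using nz[OF eE] negative_part_eq_0 by blast
qed


section \<open>Solving the Toeplitz equations\<close>

lemma mean_inverse_arg:
  assumes f: "continuous_on circle f"
  shows "mean (\<lambda>z. f (inverse z)) = mean f"
proof -
  have "((\<lambda>t. f (unit_point t)) has_integral mean f) (cbox 0 1)"
    using integrable_comp_unit_point[OF f] by (simp add: mean_def has_integral_integrable_integral)
  from has_integral_affinity[OF this, of "-1" 1]
  have "((\<lambda>t. f (unit_point (1 - t))) has_integral mean f) {0..1}"
    by simp
  moreover have "unit_point (1 - t) = inverse (unit_point t)" for t
  proof -
    have "unit_point (1 - t) = exp (2 * of_real pi * \<i> - 2 * of_real pi * \<i> * of_real t)"
      by (simp add: unit_point_def right_diff_distrib)
    then show ?thesis by (simp add: exp_diff unit_point_def inverse_eq_divide)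
  qed
  ultimately show ?thesis by (simp add: mean_def integral_unique)
qed

lemma continuous_on_det:
  fixes a :: "'a::topological_space \<Rightarrow> complex^'m^'m"
  shows "continuous_on S a \<Longrightarrow> continuous_on S (\<lambda>z. det (a z))"
  unfolding det_def by (intro continuous_intros)

text \<open>
  Cramer's rule expresses the solution through continuous determinants.
\<close>

lemma continuous_on_linear_solution:
  fixes a :: "complex \<Rightarrow> complex^'m^'m"
  assumes a: "continuous_on S a" and b: "continuous_on S b"
    and det: "\<And>z. z \<in> S \<Longrightarrow> det (a z) \<noteq> 0" and F: "\<And>z. z \<in> S \<Longrightarrow> a z *v F z = b z"
  shows "continuous_on S F"
proof -
  have cm: "continuous_on S (\<lambda>z. (\<chi> i j. if j = k then b z $ i else a z $ i $ j) :: complex^'m^'m)" for k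
  proof (intro continuous_on_vec_lambda)
    fix i j show "continuous_on S (\<lambda>z. if j = k then b z $ i else a z $ i $ j)"
      by (cases "j = k") (auto intro!: continuous_intros a b)
  qed
  have "continuous_on S (\<lambda>z. \<chi> k. det (\<chi> i j. if j = k then b z $ i else a z $ i $ j) / det (a z))"
    using det by (intro continuous_on_vec_lambda continuous_on_divide continuous_on_det[OF cm]
        continuous_on_det[OF a]) auto
  then show ?thesis
  proof (rule continuous_on_eq)
    fix z assume "z \<in> S"
    then show "(\<chi> k. det (\<chi> i j. if j = k then b z $ i else a z $ i $ j) / det (a z)) = F z"
      using cramer[OF det, of z "F z" "b z"] F by simp
  qed
qed

lemma negative_part_scale: "negative_part d (\<lambda>k. c *s g k) z = c *s negative_part d g z"
  by (simp add: vec_eq_iff negative_part_nth sum_distrib_left mult_ac)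

text \<open>
  The unknowns are the \<open>m d\<close> coefficients of \<open>q\<close> and, in addition, the coefficient of the constant vector; the
  \<open>m d\<close> equations say that the modes \<open>-1, \<dots>, -d\<close> of \<open>F\<close> vanish. In a nontrivial solution the coefficient of the
  constant vector is nonzero by nondegeneracy, so it can be normalized to \<open>1\<close>.
\<close>

lemma toeplitz_column_solution:
  fixes a :: "complex \<Rightarrow> complex^'m^'m"
  assumes a: "continuous_on circle a" and det: "\<And>z. z \<in> circle \<Longrightarrow> det (a z) \<noteq> 0"
    and nd: "toeplitz_nondegenerate d a"
  shows "\<exists>F q. continuous_on circle F \<and> no_negative_modes d F \<and>
    (\<forall>z\<in>circle. a z *v F z = axis j 1 + negative_part d q z)"
proof -
  (* None stands for the constant vector, Some (k, s) for mode - k in direction s. *)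
  define basis :: "(nat \<times> 'm) option \<Rightarrow> complex \<Rightarrow> complex^'m"
    where "basis p = (case p of None \<Rightarrow> (\<lambda>z. axis j 1) |
    Some (k, s) \<Rightarrow> (\<lambda>z. inverse z ^ k *s axis s 1))" for p
  define R where "R p z = matrix_inv (a z) *v basis p z" for p z
  have aR: "a z *v R p z = basis p z" if "z \<in> circle" for p z
    using matrix_inv_det_nonzero(1)[OF det[OF that]] by (simp add: R_def matrix_vector_mul_assoc)
  have contR: "continuous_on circle (R p)" for p
  proof (rule continuous_on_linear_solution[OF a _ det aR])
    show "continuous_on circle (basis p)"
      unfolding basis_def vector_scalar_mult_def
      by (auto split: option.split intro!: continuous_intros)
  qed
  define I where "I = {1..d} \<times> (UNIV :: 'm set)"
  define J where "J = insert None (Some ` I)"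
  have "card I < card J" unfolding J_def I_def by (subst card_insert_disjoint) (auto simp: card_image)
  then obtain x where x: "\<exists>p\<in>J. x p \<noteq> 0"
      "\<forall>(k, i)\<in>I. (\<Sum>p\<in>J. mean (\<lambda>z. z ^ k * R p z $ i) * x p) = 0"
    using underdetermined_system[of I J "\<lambda>(k, i) p. mean (\<lambda>z. z ^ k * R p z $ i)"]
    by (auto simp: I_def J_def case_prod_beta)
  define F where "F z = (\<Sum>p\<in>J. x p *s R p z)" for z
  define q where "q k = (\<chi> s. x (Some (k, s)))" for k
  have contF: "continuous_on circle F"
    unfolding F_def vector_scalar_mult_def by (intro continuous_intros contR)
  have aF: "a z *v F z = x None *s axis j 1 + negative_part d q z" if z: "z \<in> circle" for z
  proof -
    have "a z *v F z = (\<Sum>p\<in>J. x p *s basis p z)"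
      by (simp add: F_def vec.sum vec.scale aR[OF z])
    also have "\<dots> = x None *s axis j 1 + (\<Sum>(k, s)\<in>I. x (Some (k, s)) *s (inverse z ^ k *s axis s 1))"
      unfolding J_def by (subst sum.insert) (auto simp: I_def sum.reindex basis_def case_prod_beta)
    also have "(\<Sum>(k, s)\<in>I. x (Some (k, s)) *s (inverse z ^ k *s axis s 1)) = negative_part d q z"
    proof -
      have "(\<Sum>(k, s)\<in>I. x (Some (k, s)) *s (inverse z ^ k *s axis s 1)) $ i = negative_part d q z $ i" for i
      proof -
        have "(\<Sum>(k, s)\<in>I. x (Some (k, s)) *s (inverse z ^ k *s axis s 1)) $ i
           = (\<Sum>k\<in>{1..d}. \<Sum>s\<in>UNIV. if s = i then x (Some (k, s)) * inverse z ^ k else 0)"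
          unfolding I_def sum.cartesian_product[symmetric] sum_component
          by (intro sum.cong refl) (auto simp: axis_def)
        then show ?thesis by (simp add: negative_part_nth q_def mult.commute)
      qed
      then show ?thesis by (simp add: vec_eq_iff)
    qed
    finally show ?thesis .
  qed
  have modesF: "no_negative_modes d F"
    unfolding no_negative_modes_def
  proof (intro ballI allI)
    fix k i assume k: "k \<in> {1..d}"
    have "mean (\<lambda>z. z ^ k * F z $ i) = mean (\<lambda>z. \<Sum>p\<in>J. x p * (z ^ k * R p z $ i))"
      by (simp add: F_def sum_distrib_left mult_ac)
    also have "\<dots> = (\<Sum>p\<in>J. x p * mean (\<lambda>z. z ^ k * R p z $ i))"
      by (subst mean_sum) (auto intro!: continuous_intros contR simp: mean_cmult)
    also have "\<dots> = 0" using x(2) k by (auto simp: I_def mult.commute)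
    finally show "mean (\<lambda>z. z ^ k * F z $ i) = 0" .
  qed
  have xN: "x None \<noteq> 0"
  proof
    assume "x None = 0"
    then have "\<forall>z\<in>circle. a z *v F z = negative_part d q z" using aF by simp
    then have "\<forall>k\<in>{1..d}. q k = 0"
      using nd contF modesF unfolding toeplitz_nondegenerate_def by blast
    then have "x (Some (k, s)) = 0" if "k \<in> {1..d}" for k s
      using that by (auto simp: q_def vec_eq_iff)
    then show False using x(1) \<open>x None = 0\<close> by (auto simp: J_def I_def)
  qed
  let ?c = "inverse (x None)"
  show ?thesis
  proof (intro exI[of _ "\<lambda>z. ?c *s F z"] exI[of _ "\<lambda>k. ?c *s q k"] conjI ballI)
    show "continuous_on circle (\<lambda>z. ?c *s F z)"
      unfolding vector_scalar_mult_def by (intro continuous_intros contF)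
    have "mean (\<lambda>z. z ^ k * (?c *s F z) $ i) = ?c * mean (\<lambda>z. z ^ k * F z $ i)" for k i
      unfolding mean_cmult[symmetric] by (rule mean_cong) simp
    then show "no_negative_modes d (\<lambda>z. ?c *s F z)"
      using modesF by (simp add: no_negative_modes_def)
    show "a z *v (?c *s F z) = axis j 1 + negative_part d (\<lambda>k. ?c *s q k) z" if "z \<in> circle" for z
      using xN by (simp add: vec.scale aF[OF that] negative_part_scale vector_add_ldistrib vector_smult_assoc)
  qed
qed

definition laurent_matrix :: "nat \<Rightarrow> (int \<Rightarrow> complex^'m^'m) \<Rightarrow> complex \<Rightarrow> complex^'m^'m" where
  "laurent_matrix d A z = (\<chi> i j. \<Sum>l\<in>{- int d..int d}. z powi l * A l $ i $ j)"

lemma continuous_on_laurent_matrix: "continuous_on circle (laurent_matrix d A)"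
  unfolding laurent_matrix_def by (intro continuous_intros) auto

lemma laurent_polynomial_laurent_matrix: "laurent_polynomial (\<lambda>z. laurent_matrix d A z $ i $ j)"
  unfolding laurent_matrix_def
  by (simp, intro laurent_polynomial_sum laurent_polynomial_mult laurent_polynomial_power_int
      laurent_polynomial_const)

lemma laurent_polynomial_negative_part: "laurent_polynomial (\<lambda>z. negative_part d q z $ i)"
  unfolding negative_part_nth
proof (intro laurent_polynomial_sum laurent_polynomial_mult laurent_polynomial_const)
  fix k show "laurent_polynomial (\<lambda>z. inverse z ^ k)"
    using laurent_polynomial_power_int[of "- int k"] by (simp add: power_int_minus power_inverse)
qed

text \<open>
  The constant term of \<open>v\<close> is moved into \<open>u\<close>, so that \<open>v (inverse z)\<close> has only negative modes.
\<close>

lemma splits_family_common_radius: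
  fixes f :: "'i::finite \<Rightarrow> complex \<Rightarrow> complex"
  assumes "\<And>i. splits (f i)"
  shows "\<exists>\<rho>>1. \<exists>u v. \<forall>i. u i holomorphic_on ball 0 \<rho> \<and> v i holomorphic_on ball 0 \<rho> \<and> v i 0 = 0 \<and>
    (\<forall>z\<in>circle. f i z = u i z + v i (inverse z))"
proof -
  have "\<forall>i. \<exists>\<rho> u v. \<rho> > 1 \<and> u holomorphic_on ball 0 \<rho> \<and> v holomorphic_on ball 0 \<rho> \<and>
     (\<forall>z\<in>circle. f i z = u z + v (inverse z))"
    using assms unfolding splits_def by blast
  then obtain \<rho> u v where h: "\<And>i. \<rho> i > 1" "\<And>i. u i holomorphic_on ball 0 (\<rho> i)"
    "\<And>i. v i holomorphic_on ball 0 (\<rho> i)" "\<And>i z. z \<in> circle \<Longrightarrow> f i z = u i z + v i (inverse z)"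
    by metis
  define r where "r = Min (range \<rho>)"
  have r: "r > 1" "\<And>i. r \<le> \<rho> i" using h(1) by (auto simp: r_def)
  then have sub: "ball 0 r \<subseteq> ball (0::complex) (\<rho> i)" for i using r(2) by (simp add: subset_ball)
  have "(\<lambda>z. u i z + v i 0) holomorphic_on ball 0 r" "(\<lambda>z. v i z - v i 0) holomorphic_on ball 0 r" for i
    by (intro holomorphic_intros holomorphic_on_subset[OF h(2) sub] holomorphic_on_subset[OF h(3) sub])+
  moreover have "f i z = (u i z + v i 0) + (v i (inverse z) - v i 0)" if "z \<in> circle" for i z
    using h(4)[OF that] by simp
  ultimately show ?thesis using r(1)
    by (intro exI[of _ r] conjI exI[of _ "\<lambda>i z. u i z + v i 0"] exI[of _ "\<lambda>i z. v i z - v i 0"]) auto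
qed


section \<open>Factorization of nondegenerate hermitian symbols\<close>

text \<open>
  Let \<open>F = u + w\<close>, where \<open>w(z) = v(1/z)\<close> collects the negative modes of the solution \<open>F\<close>. The modes \<open>-1, \<dots>, -d\<close>
  of \<open>w\<close> vanish, so \<open>w\<close> has only modes below \<open>-d\<close> and \<open>a w\<close> has only negative modes. On the other hand
  \<open>a w\<close> equals the right-hand side minus \<open>a u\<close>, which has no modes below \<open>-d\<close>. Hence \<open>a w\<close> is a combination
  of the modes \<open>-1, \<dots>, -d\<close>, and nondegeneracy applied to \<open>w\<close> gives \<open>w = 0\<close>.
\<close>

lemma toeplitz_column_holomorphic:
  fixes A :: "int \<Rightarrow> complex^'m^'m" and d :: nat
  defines "a \<equiv> laurent_matrix d A"
  assumes det: "\<And>z. z \<in> circle \<Longrightarrow> det (a z) \<noteq> 0" and nd: "toeplitz_nondegenerate d a"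
  shows "\<exists>\<rho>>1. \<exists>u q. (\<forall>i. u i holomorphic_on ball 0 \<rho>) \<and>
    (\<forall>z\<in>circle. a z *v (\<chi> i. u i z) = axis j 1 + negative_part d q z)"
proof -
  have conta: "continuous_on circle a" unfolding a_def by (rule continuous_on_laurent_matrix)
  obtain F q where F: "continuous_on circle F" "no_negative_modes d F"
    "\<And>z. z \<in> circle \<Longrightarrow> a z *v F z = axis j 1 + negative_part d q z"
    using toeplitz_column_solution[OF conta det nd] by metis
  have splitsF: "splits (\<lambda>z. F z $ i)" for i
  proof (rule splits_cramer[OF _ _ det F(3)])
    show "laurent_polynomial (\<lambda>z. a z $ i $ j)" for i j
      unfolding a_def by (rule laurent_polynomial_laurent_matrix)
    show "laurent_polynomial (\<lambda>z. (axis j 1 + negative_part d q z) $ i)" for i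
      by (simp, intro laurent_polynomial_add laurent_polynomial_const laurent_polynomial_negative_part)
  qed
  from splits_family_common_radius[of "\<lambda>i z. F z $ i", OF splitsF]
  obtain \<rho> u v where \<rho>: "\<rho> > 1" and u: "\<And>i. u i holomorphic_on ball 0 \<rho>"
    and v: "\<And>i. v i holomorphic_on ball 0 \<rho>" "\<And>i. v i 0 = 0"
    and uv: "\<And>i z. z \<in> circle \<Longrightarrow> F z $ i = u i z + v i (inverse z)" by metis
  have sub: "circle \<subseteq> ball 0 \<rho>" using \<rho> by auto
  have contu: "continuous_on circle (u i)" and contv: "continuous_on circle (v i)" for i
    using u v sub by (meson holomorphic_on_imp_continuous_on holomorphic_on_subset)+
  have contvi: "continuous_on circle (\<lambda>z. v i (inverse z))" for i
    by (rule continuous_on_compose2[OF contv]) (auto intro!: continuous_intros simp: norm_inverse)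
  have contp: "continuous_on circle (\<lambda>z. z powi e)" for e
    by (intro continuous_intros) auto
  have modes: "mean (\<lambda>z. z powi e * v i (inverse z)) = 0" if "e \<le> int d" for e i
  proof (cases "e > 0")
    case True
    define k where "k = nat e"
    have k: "e = int k" "k \<in> {1..d}" using True that by (auto simp: k_def)
    have "mean (\<lambda>z. z ^ k * F z $ i) = mean (\<lambda>z. z ^ k * u i z + z ^ k * v i (inverse z))"
      by (rule mean_cong) (simp add: uv distrib_left)
    also have "\<dots> = mean (\<lambda>z. z ^ k * u i z) + mean (\<lambda>z. z ^ k * v i (inverse z))"
      by (intro mean_add continuous_intros contu contvi)
    finally show ?thesis
      using F(2) mean_power_holomorphic[OF u \<rho>, of k] k by (simp add: no_negative_modes_def)
  next
    case False
    define k where "k = nat (- e)"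
    have k: "e = - int k" using False by (simp add: k_def)
    have "mean (\<lambda>z. z powi e * v i (inverse z)) = mean (\<lambda>z. (\<lambda>w. w ^ k * v i w) (inverse z))"
      unfolding k by (rule mean_cong) (simp add: power_int_minus power_inverse)
    also have "\<dots> = mean (\<lambda>z. z ^ k * v i z)"
      by (rule mean_inverse_arg) (intro continuous_intros contv)
    also have "\<dots> = 0"
      using mean_power_holomorphic[OF v(1) \<rho>, of k] mean_inverse_power_holomorphic[OF v(1) \<rho>, of i 0] v(2)
      by (cases "k = 0") auto
    finally show ?thesis .
  qed
  define w where "w z = (\<chi> i. v i (inverse z))" for z
  have contw: "continuous_on circle w" unfolding w_def by (intro continuous_on_vec_lambda contvi)
  have Fuw: "F z = (\<chi> i. u i z) + w z" if "z \<in> circle" for z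
    by (simp add: vec_eq_iff w_def uv[OF that])
  define U where "U i z = z ^ d * axis j 1 $ i + (\<Sum>k\<in>{1..d}. z ^ (d - k) * q k $ i)
     - (\<Sum>s\<in>UNIV. \<Sum>l\<in>{- int d..int d}. z ^ nat (int d + l) * A l $ i $ s * u s z)" for i z
  have U: "U i holomorphic_on ball 0 \<rho>" for i
    unfolding U_def by (intro holomorphic_intros u)
  have Ua: "U i z = z ^ d * (a z *v w z) $ i" if z: "z \<in> circle" for i z
  proof -
    have "z \<noteq> 0" using z by auto
    have "a z *v w z = axis j 1 + negative_part d q z - a z *v (\<chi> i. u i z)"
      using F(3)[OF z] by (simp add: Fuw[OF z] matrix_vector_right_distrib eq_diff_eq add.commute)
    then have "(a z *v w z) $ i = axis j 1 $ i + (\<Sum>k\<in>{1..d}. inverse z ^ k * q k $ i)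
        - (\<Sum>s\<in>UNIV. \<Sum>l\<in>{- int d..int d}. z powi l * A l $ i $ s * u s z)"
      by (simp add: negative_part_nth matrix_vector_mult_def a_def laurent_matrix_def sum_distrib_right)
    moreover have "z ^ d * (\<Sum>k\<in>{1..d}. inverse z ^ k * q k $ i) = (\<Sum>k\<in>{1..d}. z ^ (d - k) * q k $ i)"
      unfolding sum_distrib_left using \<open>z \<noteq> 0\<close>
      by (intro sum.cong refl) (simp add: power_diff power_inverse field_simps)
    moreover have "z ^ d * (\<Sum>s\<in>UNIV. \<Sum>l\<in>{- int d..int d}. z powi l * A l $ i $ s * u s z)
        = (\<Sum>s\<in>UNIV. \<Sum>l\<in>{- int d..int d}. z ^ nat (int d + l) * A l $ i $ s * u s z)"
      unfolding sum_distrib_left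
    proof (intro sum.cong refl)
      fix s l assume "l \<in> {- int d..int d}"
      then have "z ^ nat (int d + l) = z powi (int d + l)" by (simp add: power_int_def)
      also have "\<dots> = z ^ d * z powi l" using \<open>z \<noteq> 0\<close> by (simp add: power_int_add)
      finally show "z ^ d * (z powi l * A l $ i $ s * u s z) = z ^ nat (int d + l) * A l $ i $ s * u s z"
        by simp
    qed
    ultimately show ?thesis by (simp add: U_def right_diff_distrib distrib_left)
  qed
  have van: "mean (\<lambda>z. U i z / z ^ k) = 0" if k: "k \<ge> d" for i k
  proof -
    have "mean (\<lambda>z. U i z / z ^ k) = mean (\<lambda>z. \<Sum>s\<in>UNIV. \<Sum>l\<in>{- int d..int d}.
        A l $ i $ s * (z powi (int d - int k + l) * v s (inverse z)))"
    proof (rule mean_cong)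
      fix z :: complex assume z: "z \<in> circle"
      then have "z \<noteq> 0" by auto
      have "U i z / z ^ k = (\<Sum>s\<in>UNIV. \<Sum>l\<in>{- int d..int d}. z ^ d * (z powi l * A l $ i $ s * v s (inverse z)) / z ^ k)"
        by (simp add: Ua[OF z] matrix_vector_mult_def a_def laurent_matrix_def w_def
            sum_distrib_right sum_distrib_left sum_divide_distrib)
      also have "\<dots> = (\<Sum>s\<in>UNIV. \<Sum>l\<in>{- int d..int d}. A l $ i $ s * (z powi (int d - int k + l) * v s (inverse z)))"
        using \<open>z \<noteq> 0\<close> by (intro sum.cong refl) (simp add: power_int_add power_int_diff)
      finally show "U i z / z ^ k = \<dots>" .
    qed
    also have "\<dots> = (\<Sum>s\<in>UNIV. \<Sum>l\<in>{- int d..int d}. A l $ i $ s * mean (\<lambda>z. z powi (int d - int k + l) * v s (inverse z)))"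
      using contvi contp
      by (simp add: mean_sum mean_cmult continuous_on_sum continuous_on_mult continuous_on_const)
    also have "\<dots> = 0" using k by (intro sum.neutral ballI) (simp add: modes)
    finally show ?thesis .
  qed
  (* Mode - m of a w is mode d - m of U, because U = z ^ d a w on the circle. *)
  define g where "g m = (\<chi> i. mean (\<lambda>z. U i z / z ^ (d - m)))" for m
  have aw: "a z *v w z = negative_part d g z" if z: "z \<in> circle" for z
  proof -
    have "z \<noteq> 0" using z by auto
    have "(a z *v w z) $ i = negative_part d g z $ i" for i
    proof -
      have "z ^ d * (a z *v w z) $ i = (\<Sum>k<d. mean (\<lambda>z. U i z / z ^ k) * z ^ k)"
        unfolding Ua[OF z, symmetric] using z sub by (intro holomorphic_eq_polynomial[OF U \<rho> van]) auto
      also have "\<dots> = (\<Sum>m\<in>{1..d}. mean (\<lambda>z. U i z / z ^ (d - m)) * z ^ (d - m))"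
        by (rule sum.reindex_bij_witness[of _ "\<lambda>m. d - m" "\<lambda>k. d - k"]) auto
      also have "\<dots> = z ^ d * negative_part d g z $ i"
        unfolding negative_part_nth g_def sum_distrib_left using \<open>z \<noteq> 0\<close>
        by (intro sum.cong refl) (simp add: power_diff power_inverse field_simps)
      finally show ?thesis using \<open>z \<noteq> 0\<close> by simp
    qed
    then show ?thesis by (simp add: vec_eq_iff)
  qed
  have "no_negative_modes d w"
    unfolding no_negative_modes_def w_def
  proof (intro ballI allI)
    fix k i assume "k \<in> {1..d}"
    then show "mean (\<lambda>z. z ^ k * (\<chi> i. v i (inverse z)) $ i) = 0" using modes[of "int k" i] by simp
  qed
  then have "\<forall>k\<in>{1..d}. g k = 0"
    using nd contw aw unfolding toeplitz_nondegenerate_def by blast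
  then have "a z *v w z = 0" if "z \<in> circle" for z
    using aw[OF that] by (simp add: negative_part_def)
  then have "w z = 0" if "z \<in> circle" for z
    using det_nonzero_kernel[OF det] that by blast
  then have "a z *v (\<chi> i. u i z) = axis j 1 + negative_part d q z" if "z \<in> circle" for z
    using F(3)[OF that] Fuw[OF that] that by simp
  then show ?thesis using \<rho> u by blast
qed

definition matrix_polynomial :: "nat \<Rightarrow> (nat \<Rightarrow> complex^'m^'m) \<Rightarrow> complex \<Rightarrow> complex^'m^'m" where
  "matrix_polynomial d B z = (\<chi> i j. \<Sum>k\<le>d. z ^ k * B k $ i $ j)"

lemma matrix_polynomial_0: "matrix_polynomial d B 0 = B 0"
proof -
  have "(\<Sum>k\<le>d. 0 ^ k * B k $ i $ j) = B 0 $ i $ j" for i j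
    by (subst sum.remove[of _ 0]) (auto simp: power_0_left)
  then show ?thesis by (simp add: vec_eq_iff matrix_polynomial_def)
qed

lemma infinite_circle: "infinite circle"
proof
  assume "finite circle"
  moreover have "connected circle" by (simp add: connected_sphere)
  ultimately have "circle = {} \<or> (\<exists>x. circle = {x})" by (simp add: connected_finite_iff_sing)
  moreover have "1 \<in> circle" "- 1 \<in> circle" by simp_all
  ultimately show False by (metis empty_iff one_neq_neg_one singletonD)
qed

text \<open>
  The determinant is a polynomial with value \<open>1\<close> at \<open>0\<close>, so it has only finitely many zeros.
\<close>

lemma matrix_polynomial_det_nonzero_on_circle:
  assumes "B 0 = mat 1"
  shows "\<exists>z\<in>circle. det (matrix_polynomial d B z) \<noteq> 0"
proof -
  define p where "p = det (\<chi> i j. \<Sum>k\<le>d. monom (B k $ i $ j) k)"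
  have p: "poly p z = det (matrix_polynomial d B z)" for z
    by (simp add: p_def matrix_polynomial_def det_def poly_sum poly_prod poly_monom mult.commute flip: of_int_poly)
  have "poly p 0 = 1" by (simp add: p matrix_polynomial_0 assms)
  then have "finite {z. poly p z = 0}" by (intro poly_roots_finite) auto
  then have "\<not> circle \<subseteq> {z. poly p z = 0}" using infinite_circle finite_subset by blast
  then show ?thesis by (auto simp: p)
qed

text \<open>
  The column solutions form a matrix \<open>F\<close>, holomorphic beyond the disc, with \<open>a F = Q\<^sup>*\<close> on the circle and \<open>Q\<close>
  polynomial. There \<open>Q F = F\<^sup>* a F\<close> is hermitian; since \<open>Q F\<close> is also holomorphic in the disc, its modes of
  positive index are conjugate to vanishing ones, and \<open>Q F\<close> is a constant \<open>F0\<close>. Invertibility of \<open>F0\<close> can be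
  tested at any single point of the circle where \<open>Q\<close> is invertible. It implies that \<open>Q\<close> is invertible throughout
  the disc, and \<open>a = Q\<^sup>* F\<^sup>-\<^sup>1 = Q\<^sup>* F0\<^sup>-\<^sup>1 Q\<close>.
\<close>

lemma hermitian_symbol_factorization:
  fixes A :: "int \<Rightarrow> complex^'m^'m" and d :: nat
  defines "a \<equiv> laurent_matrix d A"
  assumes herm: "\<And>z. z \<in> circle \<Longrightarrow> hermitian_mat (a z)"
    and det: "\<And>z. z \<in> circle \<Longrightarrow> det (a z) \<noteq> 0" and nd: "toeplitz_nondegenerate d a"
  shows "\<exists>B H. hermitian_mat H \<and> det H \<noteq> 0 \<and> B 0 = mat 1 \<and>
    (\<forall>z\<in>cball 0 1. det (matrix_polynomial d B z) \<noteq> 0) \<and>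
    (\<forall>z\<in>circle. a z = conj_transpose (matrix_polynomial d B z) ** H ** matrix_polynomial d B z)"
proof -
  have "\<forall>j. \<exists>\<rho> u q. \<rho> > 1 \<and> (\<forall>i. u i holomorphic_on ball 0 \<rho>) \<and>
    (\<forall>z\<in>circle. a z *v (\<chi> i. u i z) = axis j 1 + negative_part d q z)"
    using toeplitz_column_holomorphic[of d A, folded a_def, OF det nd] by blast
  then obtain \<rho> u q where \<rho>: "\<And>j. \<rho> j > 1" and u: "\<And>j i. u j i holomorphic_on ball 0 (\<rho> j)"
    and q: "\<And>j z. z \<in> circle \<Longrightarrow> a z *v (\<chi> i. u j i z) = axis j 1 + negative_part d (q j) z"
    by metis
  define r where "r = Min (range \<rho>)"
  have r: "r > 1" "\<And>j. r \<le> \<rho> j" using \<rho> by (auto simp: r_def)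
  have u: "u j i holomorphic_on ball 0 r" for j i
    using holomorphic_on_subset[OF u] r(2)[of j] by (simp add: subset_ball)
  define B where "B k = (if k = 0 then mat 1 else (\<chi> i j. cnj (q i k $ j)))" for k
  define Q where "Q = matrix_polynomial d B"
  define F where "F z = (\<chi> i j. u j i z)" for z
  have Q_nth: "Q z $ i $ j = mat 1 $ i $ j + (\<Sum>k\<in>{1..d}. z ^ k * cnj (q i k $ j))" for z i j
  proof -
    have "{..d} = insert 0 {1..d}" by auto
    then show ?thesis by (simp add: Q_def matrix_polynomial_def B_def)
  qed
  have aF: "a z ** F z = conj_transpose (Q z)" if z: "z \<in> circle" for z
  proof -
    have "(a z ** F z) $ i $ j = conj_transpose (Q z) $ i $ j" for i j
    proof -
      have "(a z ** F z) $ i $ j = (a z *v (\<chi> i. u j i z)) $ i"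
        by (simp add: matrix_matrix_mult_def matrix_vector_mult_def F_def)
      also have "\<dots> = axis j 1 $ i + (\<Sum>k\<in>{1..d}. inverse z ^ k * q j k $ i)"
        by (simp add: q[OF z] negative_part_nth)
      also have "\<dots> = conj_transpose (Q z) $ i $ j"
        using cnj_inverse_circle[OF z]
        by (simp add: Q_nth axis_def mat_def) (metis complex_cnj_cnj complex_cnj_inverse)
      finally show ?thesis .
    qed
    then show ?thesis by (simp add: vec_eq_iff)
  qed
  define Y where "Y z = Q z ** F z" for z
  have Yhol: "(\<lambda>z. Y z $ i $ j) holomorphic_on ball 0 r" for i j
    unfolding Y_def matrix_matrix_mult_def F_def Q_nth by (simp, intro holomorphic_intros u)
  have Yherm: "hermitian_mat (Y z)" if z: "z \<in> circle" for z
  proof -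
    have "Q z = conj_transpose (a z ** F z)" by (simp add: aF[OF z])
    also have "\<dots> = conj_transpose (F z) ** a z"
      using herm[OF z] by (simp add: conj_transpose_mult hermitian_mat_def)
    finally show ?thesis
      unfolding Y_def by (simp add: hermitian_congruence[OF herm[OF z]])
  qed
  define F0 where "F0 = (\<chi> i j. mean (\<lambda>z. Y z $ i $ j))"
  have Yconst: "Y z = F0" if z: "z \<in> ball 0 r" for z
  proof -
    have van: "mean (\<lambda>z. Y z $ i $ j / z ^ k) = 0" if k: "k \<ge> 1" for i j k
    proof -
      have "mean (\<lambda>z. Y z $ i $ j / z ^ k) = mean (\<lambda>z. cnj (z ^ k * Y z $ j $ i))"
      proof (rule mean_cong)
        fix z assume z: "z \<in> circle"
        have "cnj z = inverse z" using cnj_inverse_circle[OF z] by (metis complex_cnj_cnj)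
        then show "Y z $ i $ j / z ^ k = cnj (z ^ k * Y z $ j $ i)"
          using Yherm[OF z] by (simp add: hermitian_mat_nth divide_inverse power_inverse mult.commute)
      qed
      also have "\<dots> = cnj (mean (\<lambda>z. z ^ k * Y z $ j $ i))" by (rule mean_cnj)
      also have "\<dots> = 0" using mean_power_holomorphic[OF Yhol r(1)] k by simp
      finally show ?thesis .
    qed
    have "Y z $ i $ j = F0 $ i $ j" for i j
      using holomorphic_eq_polynomial[OF Yhol r(1) van z] by (simp add: F0_def)
    then show ?thesis by (simp add: vec_eq_iff)
  qed
  have sub: "cball 0 1 \<subseteq> ball (0::complex) r" "circle \<subseteq> ball 0 r" using r(1) by auto
  have QF: "Q z ** F z = F0" if "z \<in> ball 0 r" for z using Yconst[OF that] by (simp add: Y_def)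
  obtain z0 where z0: "z0 \<in> circle" "det (Q z0) \<noteq> 0"
    using matrix_polynomial_det_nonzero_on_circle[of B d] by (auto simp: B_def Q_def)
  have "det (a z0) * det (F z0) = cnj (det (Q z0))"
    by (metis aF[OF z0(1)] det_mul det_conj_transpose)
  then have "det (F z0) \<noteq> 0" using z0(2) by auto
  then have F0: "det F0 \<noteq> 0" using QF[of z0] z0 sub(2) by (metis det_mul mult_eq_0_iff subsetD)
  have detQ: "det (Q z) \<noteq> 0" if "z \<in> cball 0 1" for z
    using QF[of z] that sub(1) F0 by (metis det_mul mult_eq_0_iff subsetD)
  define H where "H = matrix_inv F0"
  have H: "F0 ** H = mat 1" "H ** F0 = mat 1"
    using matrix_inv_det_nonzero[OF F0] by (simp_all add: H_def)
  then have "det F0 * det H = 1" by (metis det_I det_mul)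
  then have detH: "det H \<noteq> 0" by auto
  have hermF0: "hermitian_mat F0" using Yherm[OF z0(1)] Yconst z0(1) sub(2) by auto
  have "conj_transpose H ** F0 = mat 1"
    using arg_cong[OF H(1), of conj_transpose] hermF0 by (simp add: conj_transpose_mult hermitian_mat_def)
  then have "conj_transpose H = H"
    by (metis H(1) matrix_mul_assoc matrix_mul_lid matrix_mul_rid)
  then have hermH: "hermitian_mat H" by (simp add: hermitian_mat_def)
  have "a z = conj_transpose (Q z) ** H ** Q z" if z: "z \<in> circle" for z
  proof -
    have "z \<in> cball 0 1" "z \<in> ball 0 r" using z sub(2) by auto
    have "Q z ** (F z ** H ** Q z) = Q z"
      using QF[OF \<open>z \<in> ball 0 r\<close>] H(1) by (metis matrix_mul_assoc matrix_mul_lid)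
    then have "F z ** H ** Q z = mat 1"
      using matrix_inv_det_nonzero(2)[OF detQ[OF \<open>z \<in> cball 0 1\<close>]]
      by (metis matrix_mul_assoc matrix_mul_lid)
    then have "a z = a z ** (F z ** H ** Q z)" by simp
    also have "\<dots> = conj_transpose (Q z) ** H ** Q z"
      by (simp add: matrix_mul_assoc aF[OF z])
    finally show ?thesis .
  qed
  then show ?thesis using hermH detH detQ unfolding Q_def
    by (intro exI[of _ B] exI[of _ H]) (auto simp: B_def)
qed


section \<open>Joining every element to a normal form\<close>

definition trig_poly :: "nat \<Rightarrow> (complex \<Rightarrow> complex) \<Rightarrow> bool" where
  "trig_poly d f \<longleftrightarrow> (\<exists>c. \<forall>z\<in>circle. f z = (\<Sum>l\<in>{- int d..int d}. z powi l * c l))"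

lemma trig_poly_add:
  assumes "trig_poly d f" "trig_poly d g" shows "trig_poly d (\<lambda>z. f z + g z)"
proof -
  obtain c c' where "\<forall>z\<in>circle. f z = (\<Sum>l\<in>{- int d..int d}. z powi l * c l)"
    "\<forall>z\<in>circle. g z = (\<Sum>l\<in>{- int d..int d}. z powi l * c' l)" using assms unfolding trig_poly_def by blast
  then show ?thesis unfolding trig_poly_def
    by (intro exI[of _ "\<lambda>l. c l + c' l"]) (simp add: distrib_left sum.distrib)
qed

lemma trig_poly_cmult:
  assumes "trig_poly d f" shows "trig_poly d (\<lambda>z. k * f z)"
proof -
  obtain c where "\<forall>z\<in>circle. f z = (\<Sum>l\<in>{- int d..int d}. z powi l * c l)"
    using assms unfolding trig_poly_def by blast
  then show ?thesis unfolding trig_poly_def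
    by (intro exI[of _ "\<lambda>l. k * c l"]) (simp add: sum_distrib_left mult_ac)
qed

lemma trig_poly_sum:
  "(\<And>i. i \<in> I \<Longrightarrow> trig_poly d (f i)) \<Longrightarrow> trig_poly d (\<lambda>z. \<Sum>i\<in>I. f i z)"
proof (induction I rule: infinite_finite_induct)
  case (insert i I)
  then show ?case by (simp add: trig_poly_add)
qed (auto simp: trig_poly_def intro: exI[of _ "\<lambda>_. 0"])

lemma trig_poly_power_int:
  assumes "\<bar>k\<bar> \<le> int d" shows "trig_poly d (\<lambda>z. z powi k)"
  unfolding trig_poly_def using assms
  by (intro exI[of _ "\<lambda>l. if l = k then 1 else 0"])
    (auto simp: if_distrib[of "\<lambda>x. _ * x"] cong: if_cong)

lemma trig_poly_const: "trig_poly d (\<lambda>z. k)"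
  using trig_poly_cmult[OF trig_poly_power_int[of 0 d], of k] by simp

lemma trig_poly_cong:
  "trig_poly d f \<Longrightarrow> (\<And>z. z \<in> circle \<Longrightarrow> g z = f z) \<Longrightarrow> trig_poly d g"
  unfolding trig_poly_def by simp

text \<open>
  Passes from coefficient matrices to scalar entries, where degrees are easier to follow, and
  from the bound \<open>n\<close> to the degree \<open>d = n - 1\<close>.
\<close>

lemma fejer_riesz_mat_Suc:
  "restrict h circle \<in> fejer_riesz_mat (Suc d) \<longleftrightarrow> (\<forall>i j. trig_poly d (\<lambda>z. h z $ i $ j))"
proof
  assume "restrict h circle \<in> fejer_riesz_mat (Suc d)"
  then obtain c :: "int \<Rightarrow> complex^'a^'a" where "restrict h circle = restrict
        (\<lambda>z. \<chi> i j. \<Sum>k = - int (Suc d) + 1..int (Suc d) - 1. z powi k * c k $ i $ j) circle"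
    by (auto simp: fejer_riesz_mat_def)
  then have "h z = (\<chi> i j. \<Sum>k = - int d..int d. z powi k * c k $ i $ j)" if "z \<in> circle" for z
    using that by (simp add: fun_eq_iff restrict_def) meson
  then show "\<forall>i j. trig_poly d (\<lambda>z. h z $ i $ j)"
    unfolding trig_poly_def by (intro allI, rule_tac x = "\<lambda>k. c k $ i $ j" in exI) auto
next
  assume "\<forall>i j. trig_poly d (\<lambda>z. h z $ i $ j)"
  then obtain c where c: "\<And>i j z. z \<in> circle \<Longrightarrow> h z $ i $ j = (\<Sum>l\<in>{- int d..int d}. z powi l * c i j l)"
    unfolding trig_poly_def by metis
  have "restrict h circle = restrict
        (\<lambda>z. \<chi> i j. \<Sum>k = - int (Suc d) + 1..int (Suc d) - 1. z powi k * (\<chi> i j. c i j k) $ i $ j) circle"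
    by (rule restrict_ext) (simp add: vec_eq_iff c)
  then show "restrict h circle \<in> fejer_riesz_mat (Suc d)"
    unfolding fejer_riesz_mat_def by (intro CollectI exI[of _ "\<lambda>k. \<chi> i j. c i j k"])
qed

lemma fejer_riesz_mat_restrict: "a \<in> fejer_riesz_mat n \<Longrightarrow> restrict a circle = a"
  by (auto simp: fejer_riesz_mat_def)

lemma herm_invI:
  assumes "\<And>i j. trig_poly d (\<lambda>z. h z $ i $ j)"
    "\<And>z. z \<in> circle \<Longrightarrow> hermitian_mat (h z)" "\<And>z. z \<in> circle \<Longrightarrow> det (h z) \<noteq> 0"
  shows "restrict h circle \<in> herm_inv (Suc d)"
  using assms by (auto simp: herm_inv_def fejer_riesz_mat_Suc)

abbreviation joined :: "nat \<Rightarrow> (complex \<Rightarrow> complex^'m^'m) \<Rightarrow> (complex \<Rightarrow> complex^'m^'m) \<Rightarrow> bool" where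
  "joined d f g \<equiv> path_component_of (herm_inv_topology (Suc d)) (restrict f circle) (restrict g circle)"

text \<open>
  The path is \<open>a + t e I\<close>. It stays invertible because \<open>e\<close> is smaller than the gap \<open>\<delta>\<close> of the spectrum of \<open>a\<close>
  around \<open>0\<close>.
\<close>

lemma joined_nondegenerate:
  fixes a :: "complex \<Rightarrow> complex^'m^'m"
  assumes a: "a \<in> herm_inv (Suc d)"
  shows "\<exists>A. joined d a (laurent_matrix d A) \<and> toeplitz_nondegenerate d (laurent_matrix d A)"
proof -
  have fr: "a \<in> fejer_riesz_mat (Suc d)" and herm: "\<And>z. z \<in> circle \<Longrightarrow> hermitian_mat (a z)"
    and det: "\<And>z. z \<in> circle \<Longrightarrow> det (a z) \<noteq> 0" using a by (auto simp: herm_inv_def)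
  have cont: "continuous_on circle a" by (rule continuous_on_fejer_riesz[OF fr])
  have trig: "trig_poly d (\<lambda>z. a z $ i $ j)" for i j
    using fr fejer_riesz_mat_restrict[OF fr] fejer_riesz_mat_Suc[of a d] by simp
  obtain \<delta> where \<delta>: "\<delta> > 0" "\<And>z x. z \<in> circle \<Longrightarrow> \<delta> * norm x \<le> norm (a z *v x)"
    using matrix_family_bounded_below[OF cont det] by blast
  obtain e where e: "0 < e" "e < \<delta>" "toeplitz_nondegenerate d (\<lambda>z. a z + mat (complex_of_real e))"
    using nondegenerate_perturbation[OF cont herm \<delta>(2,1)] by blast
  define h where "h t z = a z + mat (complex_of_real (t * e))" for t z
  have trigh: "trig_poly d (\<lambda>z. h t z $ i $ j)" for t i j
    unfolding h_def vector_add_component by (intro trig_poly_add trig trig_poly_const)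
  have deth: "det (h t z) \<noteq> 0" if "t \<in> {0..1}" "z \<in> circle" for t z
  proof
    assume "det (h t z) = 0"
    then have "\<not> invertible (h t z)" by (simp add: invertible_det_nz)
    then obtain x where x: "x \<noteq> 0" "h t z *v x = 0"
      using matrix_left_invertible_ker invertible_left_inverse by blast
    have "a z *v x = - (complex_of_real (t * e) *s x)"
      using x(2) unfolding h_def by (simp add: matrix_vector_mult_add_rdistrib mat_mult_vec eq_neg_iff_add_eq_0)
    then have "norm (a z *v x) = t * e * norm x"
      using that e by (simp add: norm_vector_scalar_mult norm_mult)
    also have "\<dots> \<le> e * norm x" using that e(1) by (intro mult_right_mono) auto
    also have "\<dots> < \<delta> * norm x" using e x(1) by simp
    finally show False using \<delta>(2)[OF that(2), of x] by simp
  qed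
  have conth: "continuous_on ({0..1} \<times> circle) (\<lambda>x. h (fst x) (snd x))"
  proof -
    have "continuous_on ({0..1::real} \<times> circle) (\<lambda>x. a (snd x))"
      by (rule continuous_on_compose2[OF cont]) (auto intro: continuous_intros)
    moreover have "continuous_on ({0..1::real} \<times> circle) (\<lambda>x. mat (complex_of_real (fst x * e)) :: complex^'m^'m)"
      unfolding mat_def
    proof (intro continuous_on_vec_lambda)
      fix i j :: 'm
      show "continuous_on ({0..1::real} \<times> circle) (\<lambda>x. if i = j then complex_of_real (fst x * e) else 0)"
        by (cases "i = j") (auto intro!: continuous_intros)
    qed
    ultimately show ?thesis unfolding h_def by (rule continuous_on_add)
  qed
  have "restrict (h t) circle \<in> herm_inv (Suc d)" if t: "t \<in> {0..1}" for t
  proof (rule herm_invI[OF trigh _ deth[OF t]])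
    show "hermitian_mat (h t z)" if "z \<in> circle" for z
      unfolding h_def by (rule hermitian_add_scalar[OF herm[OF that]])
  qed
  then have "joined d (h 0) (h 1)" by (rule circle_family_path[OF conth])
  moreover have "h 0 = a" by (auto simp: h_def fun_eq_iff mat_def vec_eq_iff)
  moreover obtain c where c: "\<And>i j z. z \<in> circle \<Longrightarrow> h 1 z $ i $ j = (\<Sum>l\<in>{- int d..int d}. z powi l * c i j l)"
    using trigh[of 1] unfolding trig_poly_def by metis
  define A where "A l = (\<chi> i j. c i j l)" for l
  have h1: "h 1 z = laurent_matrix d A z" if "z \<in> circle" for z
    by (simp add: vec_eq_iff laurent_matrix_def c[OF that] A_def)
  then have "restrict (h 1) circle = restrict (laurent_matrix d A) circle" by (rule restrict_ext)
  moreover have "toeplitz_nondegenerate d (laurent_matrix d A)"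
    using e(3) h1 by (simp add: toeplitz_nondegenerate_def h_def)
  ultimately show ?thesis by metis
qed

text \<open>
  The path is \<open>Q(t z)\<^sup>* H Q(t z)\<close>. Its degree is at most \<open>d\<close> since \<open>Q\<close> contributes the modes \<open>0, \<dots>, d\<close> and
  \<open>Q\<^sup>*\<close> the modes \<open>-d, \<dots>, 0\<close>; it is invertible since \<open>t z\<close> stays in the closed disc.
\<close>

lemma joined_constant:
  fixes A :: "int \<Rightarrow> complex^'m^'m"
  assumes a: "restrict (laurent_matrix d A) circle \<in> herm_inv (Suc d)"
    and nd: "toeplitz_nondegenerate d (laurent_matrix d A)"
  shows "\<exists>H. hermitian_mat H \<and> det H \<noteq> 0 \<and> joined d (laurent_matrix d A) (\<lambda>z. H)"
proof -
  have "\<And>z. z \<in> circle \<Longrightarrow> hermitian_mat (laurent_matrix d A z)"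
    "\<And>z. z \<in> circle \<Longrightarrow> det (laurent_matrix d A z) \<noteq> 0" using a by (auto simp: herm_inv_def)
  from hermitian_symbol_factorization[OF this nd]
  obtain B H where H: "hermitian_mat H" "det H \<noteq> 0" and B0: "B 0 = mat 1"
    and detQ: "\<And>z. z \<in> cball 0 1 \<Longrightarrow> det (matrix_polynomial d B z) \<noteq> 0"
    and fact: "\<And>z. z \<in> circle \<Longrightarrow> laurent_matrix d A z =
      conj_transpose (matrix_polynomial d B z) ** H ** matrix_polynomial d B z" by blast
  define Q where "Q = matrix_polynomial d B"
  define h where "h t z = conj_transpose (Q (of_real t * z)) ** H ** Q (of_real t * z)" for t :: real and z
  have ball: "of_real t * z \<in> cball 0 1" if "t \<in> {0..1}" "z \<in> circle" for t :: real and z :: complex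
    using that by (simp add: norm_mult)
  have h_nth: "h t z $ i $ j = (\<Sum>s\<in>UNIV. \<Sum>r\<in>UNIV. cnj (Q (of_real t * z) $ r $ i) * H $ r $ s * Q (of_real t * z) $ s $ j)" for t z i j
    by (simp add: h_def matrix_matrix_mult_def sum_distrib_right)
  have "trig_poly d (\<lambda>z. h t z $ i $ j)" for t i j
    unfolding h_nth
  proof (intro trig_poly_sum)
    fix r s
    (* On the circle cnj z = inverse z, so the product of modes k and l becomes mode l - k. *)
    let ?c = "\<lambda>k l. cnj (of_real t ^ k * B k $ r $ i) * H $ r $ s * (of_real t ^ l * B l $ s $ j)"
    have "trig_poly d (\<lambda>z. \<Sum>k\<le>d. \<Sum>l\<le>d. ?c k l * z powi (int l - int k))"
      by (intro trig_poly_sum trig_poly_cmult trig_poly_power_int) auto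
    then show "trig_poly d (\<lambda>z. cnj (Q (of_real t * z) $ r $ i) * H $ r $ s * Q (of_real t * z) $ s $ j)"
    proof (rule trig_poly_cong)
      fix z assume z: "z \<in> circle"
      then have "z \<noteq> 0" by auto
      have cz: "cnj z = inverse z" using cnj_inverse_circle[OF z] by (metis complex_cnj_cnj)
      have "cnj (Q (of_real t * z) $ r $ i) * H $ r $ s * Q (of_real t * z) $ s $ j
        = (\<Sum>k\<le>d. \<Sum>l\<le>d. cnj ((of_real t * z) ^ k * B k $ r $ i) * H $ r $ s * ((of_real t * z) ^ l * B l $ s $ j))"
        unfolding Q_def matrix_polynomial_def
        by (simp add: sum_distrib_left sum_distrib_right) (rule sum.swap)
      also have "\<dots> = (\<Sum>k\<le>d. \<Sum>l\<le>d. ?c k l * z powi (int l - int k))"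
        using \<open>z \<noteq> 0\<close>
        by (intro sum.cong refl)
          (simp add: cz power_mult_distrib power_int_diff power_inverse field_simps)
      finally show "cnj (Q (of_real t * z) $ r $ i) * H $ r $ s * Q (of_real t * z) $ s $ j = \<dots>" .
    qed
  qed
  then have mem: "restrict (h t) circle \<in> herm_inv (Suc d)" if "t \<in> {0..1}" for t
    using H detQ[OF ball[OF that]]
    by (intro herm_invI) (auto simp: h_def hermitian_congruence det_mul det_conj_transpose Q_def)
  have conth: "continuous_on ({0..1} \<times> circle) (\<lambda>x. h (fst x) (snd x))"
  proof -
    have "continuous_on S (\<lambda>x. Q (of_real (fst x) * snd x))" for S :: "(real \<times> complex) set"
      unfolding Q_def matrix_polynomial_def by (intro continuous_intros)
    then show ?thesis
      unfolding h_def matrix_matrix_mult_def conj_transpose_def by (intro continuous_intros)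
  qed
  have "joined d (h 0) (h 1)" by (rule circle_family_path[OF conth mem])
  moreover have "h 0 = (\<lambda>z. H)"
    by (simp add: h_def fun_eq_iff Q_def matrix_polynomial_0 B0)
  moreover have "restrict (h 1) circle = restrict (laurent_matrix d A) circle"
    by (rule restrict_ext) (simp add: h_def fact Q_def)
  ultimately have "joined d (\<lambda>z. H) (laurent_matrix d A)" by simp
  then show ?thesis using H path_component_of_sym by metis
qed

abbreviation sign_matrix :: "'m set \<Rightarrow> complex^'m^'m" where
  "sign_matrix P \<equiv> diagonal_matrix (\<lambda>i. if i \<in> P then 1 else - 1)"

lemma joined_sign_matrix:
  fixes H :: "complex^'m^'m"
  assumes H: "hermitian_mat H" "det H \<noteq> 0" and P: "fst (signature H) = card P"
  shows "joined d (\<lambda>z. H) (\<lambda>z. sign_matrix P)"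
proof -
  obtain V where V: "det V \<noteq> 0" "conj_transpose V ** H ** V = sign_matrix P"
    using congruent_to_sign_matrix[OF H P] by blast
  obtain \<gamma> where \<gamma>: "continuous_on {0..1::real} \<gamma>" "\<gamma> 0 = mat 1" "\<gamma> 1 = V"
    "\<And>t. t \<in> {0..1} \<Longrightarrow> det (\<gamma> t) \<noteq> 0"
    using det_nonzero_path_from_identity[OF V(1)] by blast
  define h where "h t = (\<lambda>z::complex. conj_transpose (\<gamma> t) ** H ** \<gamma> t)" for t
  have "continuous_on ({0..1} \<times> circle) (\<lambda>x. \<gamma> (fst x))"
    by (rule continuous_on_compose2[OF \<gamma>(1)]) (auto intro: continuous_intros)
  then have "continuous_on ({0..1} \<times> circle) (\<lambda>x. h (fst x) (snd x))"
    unfolding h_def matrix_matrix_mult_def conj_transpose_def by (intro continuous_intros)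
  moreover have "restrict (h t) circle \<in> herm_inv (Suc d)" if "t \<in> {0..1}" for t
    using H \<gamma>(4)[OF that]
    by (intro herm_invI) (auto simp: h_def trig_poly_const hermitian_congruence det_mul det_conj_transpose)
  ultimately have "joined d (h 0) (h 1)" by (rule circle_family_path)
  then show ?thesis by (simp add: h_def \<gamma>(2,3) V(2))
qed

text \<open>
  The signature is constant along the path from \<open>a\<close> to the constant \<open>H\<close>, so the normal form of \<open>H\<close> is determined
  by the signature of \<open>a\<close>.
\<close>

lemma joined_normal_form:
  fixes a :: "complex \<Rightarrow> complex^'m^'m"
  assumes a: "a \<in> herm_inv_sig (Suc d) p q" and P: "card P = p"
  shows "joined d a (\<lambda>z. sign_matrix P)"
proof -
  have aH: "a \<in> herm_inv (Suc d)" and sig: "signature (a 1) = (p, q)"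
    using a by (auto simp: herm_inv_sig_def)
  obtain A where A: "joined d a (laurent_matrix d A)" "toeplitz_nondegenerate d (laurent_matrix d A)"
    using joined_nondegenerate[OF aH] by blast
  then have "restrict (laurent_matrix d A) circle \<in> herm_inv (Suc d)"
    by (metis path_component_of_equiv topspace_herm_inv_topology)
  from joined_constant[OF this A(2)]
  obtain H where H: "hermitian_mat H" "det H \<noteq> 0" "joined d (laurent_matrix d A) (\<lambda>z. H)" by blast
  have aJ: "joined d a (\<lambda>z. H)" using A(1) H(3) by (rule path_component_of_trans)
  then have "signature H = (p, q)"
    using signature_path_component[OF aJ, of 1] sig by simp
  then have "joined d (\<lambda>z. H) (\<lambda>z. sign_matrix P)"
    using joined_sign_matrix[OF H(1,2)] P by simp
  with aJ show ?thesis by (rule path_component_of_trans)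
qed


section \<open>Path components and signatures\<close>

lemma sign_matrix_in_herm_inv_sig:
  "restrict (\<lambda>z. sign_matrix P) circle \<in> herm_inv_sig (Suc d) (card P) (card (- P))"
proof -
  have "hermitian_mat (sign_matrix P)"
    by (auto simp: hermitian_mat_nth diagonal_matrix_def)
  then have "restrict (\<lambda>z. sign_matrix P) circle \<in> herm_inv (Suc d)"
    by (intro herm_invI trig_poly_const) (auto simp: det_diagonal_matrix)
  then show ?thesis by (simp add: herm_inv_sig_def signature_sign_matrix)
qed

lemma path_component_of_set_herm_inv:
  fixes a :: "complex \<Rightarrow> complex^'m^'m"
  assumes a: "a \<in> herm_inv_sig (Suc d) p q" and pq: "p + q = CARD('m)"
  shows "path_component_of_set (herm_inv_topology (Suc d)) a = herm_inv_sig (Suc d) p q"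
proof (intro equalityI subsetI)
  fix b :: "complex \<Rightarrow> complex^'m^'m"
  assume "b \<in> path_component_of_set (herm_inv_topology (Suc d)) a"
  then have b: "path_component_of (herm_inv_topology (Suc d)) a b" by simp
  then have "b \<in> herm_inv (Suc d)" by (metis path_component_of_equiv topspace_herm_inv_topology)
  moreover have "signature (b z) = (p, q)" if "z \<in> circle" for z
    using signature_path_component[OF b that] a that by (auto simp: herm_inv_sig_def)
  ultimately show "b \<in> herm_inv_sig (Suc d) p q" by (auto simp: herm_inv_sig_def)
next
  fix b :: "complex \<Rightarrow> complex^'m^'m"
  assume b: "b \<in> herm_inv_sig (Suc d) p q"
  have "p \<le> CARD('m)" using pq by simp
  then obtain P :: "'m set" where P: "card P = p" using obtain_subset_with_card_n by blast
  have "restrict a circle = a" "restrict b circle = b"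
    using a b fejer_riesz_mat_restrict by (auto simp: herm_inv_sig_def herm_inv_def)
  then show "b \<in> path_component_of_set (herm_inv_topology (Suc d)) a"
    using joined_normal_form[OF a P] joined_normal_form[OF b P]
    by (metis mem_Collect_eq path_component_of_sym path_component_of_trans)
qed

text \<open>
  Sets of different signature are different because they are nonempty: each contains a constant sign matrix.
\<close>

lemma path_components_of_herm_inv:
  "bij_betw (\<lambda>(p, q). herm_inv_sig (Suc d) p q) {(p, q). p + q = CARD('m)}
     (path_components_of (herm_inv_topology (Suc d) :: (complex \<Rightarrow> complex^'m^'m) topology))"
proof -
  let ?S = "\<lambda>p q. herm_inv_sig (Suc d) p q :: (complex \<Rightarrow> complex^'m^'m) set"
  let ?X = "herm_inv_topology (Suc d) :: (complex \<Rightarrow> complex^'m^'m) topology"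
  have ne: "\<exists>a. a \<in> ?S p q" if pq: "p + q = CARD('m)" for p q
  proof -
    have "p \<le> CARD('m)" using pq by simp
    then obtain P :: "'m set" where P: "card P = p" using obtain_subset_with_card_n by blast
    then have "card (- P) = q" using pq by (simp add: Compl_eq_Diff_UNIV card_Diff_subset)
    then show ?thesis using sign_matrix_in_herm_inv_sig[of P d] P by auto
  qed
  have comp: "?S p q \<in> path_components_of ?X" if pq: "p + q = CARD('m)" for p q
  proof -
    obtain a where a: "a \<in> ?S p q" using ne[OF pq] by blast
    then have "a \<in> topspace ?X" by (simp add: topspace_herm_inv_topology herm_inv_sig_def)
    then show ?thesis
      using path_component_of_set_herm_inv[OF a pq] unfolding path_components_of_def by blast
  qed
  show ?thesis
  proof (rule bij_betwI')
    fix x y :: "nat \<times> nat" assume "x \<in> {(p, q). p + q = CARD('m)}" "y \<in> {(p, q). p + q = CARD('m)}"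
    then have "fst x + snd x = CARD('m)" by auto
    from ne[OF this] obtain a where "a \<in> ?S (fst x) (snd x)" by blast
    then have sig: "signature (a 1) = x" by (simp add: herm_inv_sig_def)
    show "((\<lambda>(p, q). ?S p q) x = (\<lambda>(p, q). ?S p q) y) = (x = y)"
    proof
      assume "(\<lambda>(p, q). ?S p q) x = (\<lambda>(p, q). ?S p q) y"
      then have "a \<in> ?S (fst y) (snd y)" using \<open>a \<in> _\<close> by (simp add: case_prod_beta)
      then show "x = y" using sig by (simp add: herm_inv_sig_def)
    qed simp
  next
    fix x :: "nat \<times> nat" assume "x \<in> {(p, q). p + q = CARD('m)}"
    then show "(\<lambda>(p, q). ?S p q) x \<in> path_components_of ?X" using comp by auto
  next
    fix C assume "C \<in> path_components_of ?X"
    then obtain a where a: "a \<in> herm_inv (Suc d)" "C = path_component_of_set ?X a"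
      by (auto simp: path_components_of_def topspace_herm_inv_topology)
    define p q where "p = fst (signature (a 1))" and "q = snd (signature (a 1))"
    have "p + q = CARD('m)"
      unfolding p_def q_def using a(1) by (intro signature_sum) (auto simp: herm_inv_def)
    moreover have "a \<in> ?S p q"
    proof -
      have "signature (a z) = (p, q)" if "z \<in> circle" for z
        using signature_constant_on_circle[OF a(1) that, of 1] by (simp add: p_def q_def)
      then show ?thesis using a(1) by (simp add: herm_inv_sig_def)
    qed
    ultimately have "C = ?S p q" using a(2) path_component_of_set_herm_inv by metis
    with \<open>p + q = _\<close> show "\<exists>x\<in>{(p, q). p + q = CARD('m)}. C = (\<lambda>(p, q). ?S p q) x"
      by (intro bexI[of _ "(p, q)"]) auto
  qed
qed

lemma bij_betw_signature_label:
  "bij_betw signature_label {(p, q). p + q = m} {2 * int j - int m | j. j \<le> m}"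
proof (rule bij_betw_imageI)
  show "inj_on signature_label {(p, q). p + q = m}"
    by (auto simp: inj_on_def signature_label_def)
  have "signature_label (p, q) = 2 * int p - int m" if "p + q = m" for p q
    using that by (auto simp: signature_label_def)
  moreover have "\<exists>q. p + q = m" if "p \<le> m" for p
    using that by (intro exI[of _ "m - p"]) simp
  ultimately show "signature_label ` {(p, q). p + q = m} = {2 * int j - int m | j. j \<le> m}"
    by (auto simp: image_iff) (metis)+
qed

lemma card_signatures: "card {(p, q). p + q = (m::nat)} = m + 1"
proof -
  have "{(p, q). p + q = m} = (\<lambda>p. (p, m - p)) ` {..m}" by (auto simp: image_iff)
  moreover have "inj_on (\<lambda>p. (p, m - p)) {..m}" by (auto simp: inj_on_def)
  ultimately show ?thesis by (simp add: card_image)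
qed

theorem theorem4p3:
  fixes n :: nat
  assumes "n \<ge> 2"
  shows
    "(\<forall>p q. p + q = CARD('m) \<longrightarrow>
        path_connectedin (herm_inv_topology n)
          (herm_inv_sig n p q :: (complex \<Rightarrow> complex^'m^'m) set))
     \<and> card (path_components_of
          (herm_inv_topology n :: (complex \<Rightarrow> complex^'m^'m) topology)) = CARD('m) + 1
     \<and> bij_betw (\<lambda>(p, q). herm_inv_sig n p q) {(p, q). p + q = CARD('m)}
         (path_components_of (herm_inv_topology n :: (complex \<Rightarrow> complex^'m^'m) topology))
     \<and> (\<exists>\<phi> :: (complex \<Rightarrow> complex^'m^'m) set \<Rightarrow> int.
          (\<forall>C \<in> V0 n. \<forall>a \<in> C. \<forall>z \<in> sphere 0 1. \<phi> C = signature_label (signature (a z)))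
          \<and> bij_betw \<phi> (V0 n) {2 * int j - int CARD('m) | j. j \<le> CARD('m)})"
proof -
  obtain d where n: "n = Suc d" using assms by (metis Suc_le_D numeral_2_eq_2)
  let ?X = "herm_inv_topology n :: (complex \<Rightarrow> complex^'m^'m) topology"
  let ?D = "{(p, q). p + q = CARD('m)}"
  let ?S = "\<lambda>(p, q). herm_inv_sig n p q :: (complex \<Rightarrow> complex^'m^'m) set"
  have bij: "bij_betw ?S ?D (path_components_of ?X)"
    unfolding n by (rule path_components_of_herm_inv)
  define \<phi> where "\<phi> C = signature_label (signature ((SOME a. a \<in> C) 1))" for C :: "(complex \<Rightarrow> complex^'m^'m) set"
  have \<phi>: "\<phi> (?S x) = signature_label x" if "x \<in> ?D" for x
  proof -
    have "?S x \<in> path_components_of ?X" using bij that by (auto simp: bij_betw_def)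
    then have "?S x \<noteq> {}" by (rule nonempty_path_components_of)
    then have "(SOME a. a \<in> ?S x) \<in> ?S x" by (simp add: some_in_eq)
    then show ?thesis by (auto simp: \<phi>_def herm_inv_sig_def split: prod.splits)
  qed
  have "bij_betw (\<phi> \<circ> ?S) ?D {2 * int j - int CARD('m) | j. j \<le> CARD('m)}"
    using bij_betw_signature_label[of "CARD('m)"] \<phi> by (subst bij_betw_cong[of _ _ signature_label]) auto
  then have bij\<phi>: "bij_betw \<phi> (V0 n) {2 * int j - int CARD('m) | j. j \<le> CARD('m)}"
    unfolding V0_def using bij_betw_comp_iff[OF bij] by blast
  have "\<phi> C = signature_label (signature (a z))" if C: "C \<in> V0 n" and a: "a \<in> C" "z \<in> circle" for C a z
  proof -
    obtain x where x: "x \<in> ?D" "C = ?S x"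
      using C bij unfolding V0_def bij_betw_def by (metis (no_types, lifting) imageE)
    then have "signature (a z) = x" using a by (auto simp: herm_inv_sig_def split: prod.splits)
    then show ?thesis using \<phi>[OF x(1)] x(2) by simp
  qed
  moreover have "path_connectedin ?X (herm_inv_sig n p q)" if "p + q = CARD('m)" for p q
  proof -
    have "?S (p, q) \<in> path_components_of ?X" using bij that by (auto simp: bij_betw_def)
    then show ?thesis using path_connectedin_path_components_of by auto
  qed
  moreover have "card (path_components_of ?X) = CARD('m) + 1"
    using bij_betw_same_card[OF bij] card_signatures by metis
  ultimately show ?thesis using bij bij\<phi> by blast
qed

end
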